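(* Let $(X,b)$ be a connected weighted graph and let $m$ be a finite measure of full support on $X$. If $c_P<\infty$, then $H_m^{(N)}$ has pure point spectrum, and for all $n\in\mathbb N=\{0,1,2,\dots\}$ and all sets $F\subset X$ of cardinality $n$ such that $\delta_x\in\mathcal D$ for all $x\in F$ the following holds: (a) $$\lambda_{n+1}\ge\frac{4}{c_P\,m(X\setminus F)}.$$ (b) If, additionally, $n\ge1$, then $c_P^{X\setminus F}\le c_P<\infty$ and $$\lambda_{n+1}\ge\frac{1}{c_P^{X\setminus F}\,m(X\setminus F)}.$$
   Context: A weighted graph $(X,b)$ consists of a nonempty countable (finite or infinite) set $X$ and a symmetric function $b:X\times X\to[0,\infty)$ with $b(x,x)=0$ for all $x\in X$ (no summability or local finiteness is assumed). It is connected if for any $x,y\in X$ there are $x=x_0,x_1,\dots,x_k=y$ with $b(x_j,x_{j+1})>0$ for $0\le j<k$. Let $\mathcal D=\{f:X\to\mathbb R\mid \sum_{x,y\in X}b(x,y)|f(x)-f(y)|^2<\infty\}$ and $\mathcal E(f,g)=\frac12\sum_{x,y\in X}b(x,y)(f(x)-f(y))(g(x)-g(y))$, $\mathcal E(f)=\mathcal E(f,f)$. $\|f\|_{\mathcal V}=\sup f-\inf f$, $\|f\|_\infty=\sup|f|$, $\mathrm{supp}(f)=\{x\mid f(x)\neq0\}$; $\delta_x$ is the function equal to $1$ at $x$ and $0$ elsewhere. $c_P$ is the best (smallest) constant $c$ with $\|f\|_{\mathcal V}^2\le c\,\mathcal E(f)$ for all $f\in\mathcal D$; for $\Omega\subset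 X$, $c_P^\Omega$ is the best constant $c'$ with $\|f\|_\infty^2\le c'\mathcal E(f)$ for all $f\in\mathcal D$ with $\mathrm{supp}(f)\subset\Omega$; each is $\infty$ if no such constant exists. Full support means $m(x):=m(\{x\})>0$ for all $x$; $\ell^2(X,m)=\{f:X\to\mathbb R\mid\|f\|_2^2=\sum_x|f(x)|^2m(x)<\infty\}$. $\mathcal E^{(N)}$ is the restriction of $\mathcal E$ to $\mathcal D\cap\ell^2(X,m)$, a closed (not necessarily densely defined) form on $\ell^2(X,m)$; $H_m^{(N)}$ is the associated nonnegative selfadjoint operator in the closure of $\mathcal D\cap\ell^2(X,m)$ in $\ell^2(X,m)$. Pure point spectrum means that this Hilbert space has an orthonormal basis of eigenvectors. In the situation of the claim, $0=\lambda_0<\lambda_1\le\lambda_2\le\dots$ denote the eigenvalues of $H_m^{(N)}$ in increasing order, counted with multiplicity; if there are only finitely many, the remaining $\lambda_k$ are understood as $+\infty$, and expressions with denominator $0$ are read as $+\infty$. *)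

theory Defs
  imports "HOL-Analysis.Analysis" "HOL-Library.Equipollence"
begin

text \<open>The vertex set is the universe of a type of class \<open>countable\<close>.\<close>

definition weighted_graph :: "('x::countable \<Rightarrow> 'x \<Rightarrow> real) \<Rightarrow> bool" where
  "weighted_graph b \<longleftrightarrow>
     (\<forall>x y. 0 \<le> b x y) \<and> (\<forall>x y. b x y = b y x) \<and> (\<forall>x. b x x = 0)"

definition connected_graph :: "('x::countable \<Rightarrow> 'x \<Rightarrow> real) \<Rightarrow> bool" where
  "connected_graph b \<longleftrightarrow> (\<forall>x y. (\<lambda>u v. b u v > 0)\<^sup>*\<^sup>* x y)"

definition dirichlet_space :: "('x::countable \<Rightarrow> 'x \<Rightarrow> real) \<Rightarrow> ('x \<Rightarrow> real) set" where
  "dirichlet_space b = {f. (\<lambda>(x, y). b x y * \<bar>f x - f y\<bar>\<^sup>2) summable_on UNIV}"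

definition energy :: "('x::countable \<Rightarrow> 'x \<Rightarrow> real) \<Rightarrow> ('x \<Rightarrow> real) \<Rightarrow> ('x \<Rightarrow> real) \<Rightarrow> real" where
  "energy b f g = (1/2) * (\<Sum>\<^sub>\<infinity>(x, y)\<in>UNIV. b x y * (f x - f y) * (g x - g y))"

definition variation_norm :: "('x \<Rightarrow> real) \<Rightarrow> ereal" where
  "variation_norm f = (SUP x. ereal (f x)) - (INF x. ereal (f x))"

definition sup_norm :: "('x \<Rightarrow> real) \<Rightarrow> ereal" where
  "sup_norm f = (SUP x. ereal \<bar>f x\<bar>)"

definition supp :: "('x \<Rightarrow> real) \<Rightarrow> 'x set" where
  "supp f = {x. f x \<noteq> 0}"

text \<open>Best constants are infima in the extended reals, so they are \<open>\<infinity>\<close> if no admissible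
  constant exists. Constants are required to be nonnegative; this matters only when the energy
  vanishes on all competitors, where the best constant is then \<open>0\<close>.\<close>

definition poincare_const :: "('x::countable \<Rightarrow> 'x \<Rightarrow> real) \<Rightarrow> ereal" where
  "poincare_const b = Inf {ereal c |c. 0 \<le> c \<and>
     (\<forall>f \<in> dirichlet_space b. (variation_norm f)\<^sup>2 \<le> ereal (c * energy b f f))}"

definition poincare_const_on :: "('x::countable \<Rightarrow> 'x \<Rightarrow> real) \<Rightarrow> 'x set \<Rightarrow> ereal" where
  "poincare_const_on b \<Omega> = Inf {ereal c |c. 0 \<le> c \<and>
     (\<forall>f \<in> dirichlet_space b. supp f \<subseteq> \<Omega> \<longrightarrow> (sup_norm f)\<^sup>2 \<le> ereal (c * energy b f f))}"

definition full_support_measure :: "'x::countable measure \<Rightarrow> bool" where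
  "full_support_measure M \<longleftrightarrow> sets M = UNIV \<and> (\<forall>x. 0 < emeasure M {x})"

text \<open>For a finite measure of full support, distinct functions are distinct elements of
  \<open>\<ell>\<^sup>2(X,m)\<close>, so no passage to classes of functions is needed.\<close>

definition ell2 :: "'x measure \<Rightarrow> ('x \<Rightarrow> real) set" where
  "ell2 M = {f. (\<lambda>x. \<bar>f x\<bar>\<^sup>2 * measure M {x}) summable_on UNIV}"

definition ell2_inner :: "'x measure \<Rightarrow> ('x \<Rightarrow> real) \<Rightarrow> ('x \<Rightarrow> real) \<Rightarrow> real" where
  "ell2_inner M f g = (\<Sum>\<^sub>\<infinity>x. f x * g x * measure M {x})"

definition ell2_norm :: "'x measure \<Rightarrow> ('x \<Rightarrow> real) \<Rightarrow> real" where
  "ell2_norm M f = sqrt (ell2_inner M f f)"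

definition ell2_closure :: "'x measure \<Rightarrow> ('x \<Rightarrow> real) set \<Rightarrow> ('x \<Rightarrow> real) set" where
  "ell2_closure M V = {f \<in> ell2 M. \<forall>\<epsilon>>0. \<exists>g\<in>V. ell2_norm M (\<lambda>x. f x - g x) < \<epsilon>}"

definition fun_span :: "('x \<Rightarrow> real) set \<Rightarrow> ('x \<Rightarrow> real) set" where
  "fun_span B = {(\<lambda>x. \<Sum>e\<in>S. c e * e x) |S c. finite S \<and> S \<subseteq> B}"

definition orthonormal_basis :: "'x measure \<Rightarrow> ('x \<Rightarrow> real) set \<Rightarrow> ('x \<Rightarrow> real) set \<Rightarrow> bool" where
  "orthonormal_basis M V B \<longleftrightarrow> B \<subseteq> V \<and>
     (\<forall>e\<in>B. \<forall>e'\<in>B. ell2_inner M e e' = (if e = e' then 1 else 0)) \<and>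
     V \<subseteq> ell2_closure M (fun_span B)"

definition form_domain :: "('x::countable \<Rightarrow> 'x \<Rightarrow> real) \<Rightarrow> 'x measure \<Rightarrow> ('x \<Rightarrow> real) set" where
  "form_domain b M = dirichlet_space b \<inter> ell2 M"

definition neumann_hilbert :: "('x::countable \<Rightarrow> 'x \<Rightarrow> real) \<Rightarrow> 'x measure \<Rightarrow> ('x \<Rightarrow> real) set" where
  "neumann_hilbert b M = ell2_closure M (form_domain b M)"

text \<open>The graph of the operator associated with the closed form given by the restriction of
  \<open>energy b\<close> to \<open>form_domain b M\<close>, in the sense of the first representation theorem:
  \<open>f\<close> is in the operator domain with image \<open>g\<close> iff \<open>\<E>(f,h) = \<langle>g,h\<rangle>\<close> for all \<open>h\<close> in the form domain.
  The image \<open>g\<close> is unique, because the form domain is dense in \<open>neumann_hilbert b M\<close>.\<close>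

definition neumann_operator ::
  "('x::countable \<Rightarrow> 'x \<Rightarrow> real) \<Rightarrow> 'x measure \<Rightarrow> (('x \<Rightarrow> real) \<times> ('x \<Rightarrow> real)) set" where
  "neumann_operator b M = {(f, g). f \<in> form_domain b M \<and> g \<in> neumann_hilbert b M \<and>
     (\<forall>h \<in> form_domain b M. energy b f h = ell2_inner M g h)}"

definition eigenspace ::
  "('x::countable \<Rightarrow> 'x \<Rightarrow> real) \<Rightarrow> 'x measure \<Rightarrow> real \<Rightarrow> ('x \<Rightarrow> real) set" where
  "eigenspace b M t = {f. (f, \<lambda>x. t * f x) \<in> neumann_operator b M}"

definition eigenvector ::
  "('x::countable \<Rightarrow> 'x \<Rightarrow> real) \<Rightarrow> 'x measure \<Rightarrow> ('x \<Rightarrow> real) \<Rightarrow> bool" where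
  "eigenvector b M f \<longleftrightarrow> f \<noteq> (\<lambda>x. 0) \<and> (\<exists>t. f \<in> eigenspace b M t)"

definition pure_point_spectrum ::
  "('x::countable \<Rightarrow> 'x \<Rightarrow> real) \<Rightarrow> 'x measure \<Rightarrow> bool" where
  "pure_point_spectrum b M \<longleftrightarrow>
     (\<exists>B. orthonormal_basis M (neumann_hilbert b M) B \<and> (\<forall>e\<in>B. eigenvector b M e))"

text \<open>The sequence \<open>ev\<close> lists the eigenvalues in increasing order: every real \<open>t\<close> occurs exactly as
  often as the Hilbert space dimension of its eigenspace (in particular never, if \<open>t\<close> is no
  eigenvalue), and the only other value allowed is \<open>\<infinity>\<close>, which fills up the sequence if there are
  only finitely many eigenvalues.\<close>

definition eigenvalue_sequence ::
  "('x::countable \<Rightarrow> 'x \<Rightarrow> real) \<Rightarrow> 'x measure \<Rightarrow> (nat \<Rightarrow> ereal) \<Rightarrow> bool" where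
  "eigenvalue_sequence b M ev \<longleftrightarrow> mono ev \<and> (\<forall>k. ev k \<noteq> -\<infinity>) \<and>
     (\<forall>t. \<exists>B. orthonormal_basis M (eigenspace b M t) B \<and> {k. ev k = ereal t} \<approx> B)"

end

theory Submission
  imports Defs "HOL-Complex_Analysis.Great_Picard"
begin

text \<open>A Poincare inequality bounds the oscillation of \<open>f\<close> by its energy, so a sequence that is
  bounded in the form norm is uniformly bounded, has a pointwise convergent subsequence, and by
  dominated convergence this subsequence converges in \<open>\<ell>\<^sup>2(X,m)\<close>. Hence Rayleigh quotients attain
  their minima and minimizing successively yields an eigenbasis.

  For the estimates, the first \<open>n + 2\<close> eigenvectors have a nonzero linear combination that vanishes on
  \<open>F\<close> and is orthogonal to the constants. Such an \<open>f\<close> takes values in an interval of length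
  at most \<open>(c\<^sub>P \<E>(f))\<^bsup>1/2\<^esup>\<close>, so the variance bound of Popoviciu on \<open>X - F\<close> gives
  \<open>\<parallel>f\<parallel>\<^sup>2 \<le> c\<^sub>P \<E>(f) m(X - F) / 4\<close>, whereas \<open>\<E>(f) \<le> \<lambda>\<^bsub>n+1\<^esub> \<parallel>f\<parallel>\<^sup>2\<close>. In part (b) vanishing on \<open>F\<close>
  is enough and the sup norm takes the place of the variance.\<close>

subsection \<open>Sums, weighted inner products and linear systems\<close>

text \<open>One weighted space covers both forms: with \<open>m\<close> on vertices it is
  \<open>ell2 M\<close>; with \<open>b\<close> on pairs of vertices, applied to gradients, its inner
  product is twice the energy. Bilinearity is thus proved once for both.\<close>

definition weighted_l2 :: "('a \<Rightarrow> real) \<Rightarrow> ('a \<Rightarrow> real) set" where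
  "weighted_l2 w = {f. (\<lambda>x. w x * (f x)\<^sup>2) summable_on UNIV}"

definition weighted_inner :: "('a \<Rightarrow> real) \<Rightarrow> ('a \<Rightarrow> real) \<Rightarrow> ('a \<Rightarrow> real) \<Rightarrow> real" where
  "weighted_inner w f g = (\<Sum>\<^sub>\<infinity>x. w x * f x * g x)"

lemma weighted_inner_commute: "weighted_inner w f g = weighted_inner w g f"
  by (simp add: weighted_inner_def mult_ac)

lemma summable_on_comparison_real:
  fixes f g :: "'a \<Rightarrow> real"
  assumes "g summable_on A" "\<And>x. x \<in> A \<Longrightarrow> \<bar>f x\<bar> \<le> g x"
  shows "f summable_on A"
  by (rule abs_summable_summable, rule Infinite_Sum.abs_summable_on_comparison_test'[OF assms(1)])
    (use assms(2) in auto)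

text \<open>Families dominated by a summable one are integrable for the counting measure, with
  integral equal to the sum, so Lebesgue's theorem on \<open>count_space UNIV\<close>
  applies.\<close>

lemma infsum_dominated_convergence:
  fixes f :: "nat \<Rightarrow> 'a \<Rightarrow> real"
  assumes g: "g summable_on UNIV"
    and dom: "\<And>n x. \<bar>f n x\<bar> \<le> g x"
    and lim: "\<And>x. (\<lambda>n. f n x) \<longlonglongrightarrow> l x"
  shows "(\<lambda>n. \<Sum>\<^sub>\<infinity>x. f n x) \<longlonglongrightarrow> (\<Sum>\<^sub>\<infinity>x. l x)"
proof -
  have dom_l: "\<bar>l x\<bar> \<le> g x" for x
    using lim[of x] dom by (intro LIMSEQ_le_const2[OF tendsto_rabs]) auto
  have int: "integrable (count_space UNIV) h" and
       inf: "infsum h UNIV = (\<integral>x. h x \<partial>count_space UNIV)"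
    if "\<And>x. \<bar>h x\<bar> \<le> g x" for h
  proof -
    have "(\<lambda>x. norm (h x)) summable_on UNIV"
      using that by (intro summable_on_comparison_real[OF g]) auto
    then have "Infinite_Set_Sum.abs_summable_on h UNIV"
      using abs_summable_equivalent by blast
    then show "integrable (count_space UNIV) h" "infsum h UNIV = (\<integral>x. h x \<partial>count_space UNIV)"
      by (simp_all add: Infinite_Set_Sum.abs_summable_on_def infsetsum_infsum[symmetric] infsetsum_def)
  qed
  have "\<bar>g x\<bar> \<le> g x" for x
    using order_trans[OF abs_ge_zero dom] by simp
  then have "(\<lambda>n. \<integral>x. f n x \<partial>count_space UNIV) \<longlonglongrightarrow> (\<integral>x. l x \<partial>count_space UNIV)"
    using lim dom by (intro integral_dominated_convergence[where w = g] int) auto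
  then show ?thesis
    by (simp add: inf[OF dom] inf[OF dom_l])
qed

text \<open>Finite partial sums pass to the limit and stay below \<open>L\<close>; for nonnegative
  terms this bound gives summability and the estimate together. It serves for the lower
  semicontinuity of the energy.\<close>

lemma fatou_infsum:
  fixes f :: "nat \<Rightarrow> 'a \<Rightarrow> real"
  assumes sum: "\<And>n. f n summable_on UNIV" and nonneg: "\<And>n x. 0 \<le> f n x"
    and lim: "\<And>x. (\<lambda>n. f n x) \<longlonglongrightarrow> l x"
    and L: "(\<lambda>n. \<Sum>\<^sub>\<infinity>x. f n x) \<longlonglongrightarrow> L"
  shows "l summable_on UNIV" and "(\<Sum>\<^sub>\<infinity>x. l x) \<le> L"
proof -
  have fin: "sum l S \<le> L" if "finite S" for S
  proof (rule LIMSEQ_le[OF _ L])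
    show "(\<lambda>n. sum (f n) S) \<longlonglongrightarrow> sum l S"
      by (intro tendsto_sum lim)
    show "\<exists>N. \<forall>n\<ge>N. sum (f n) S \<le> (\<Sum>\<^sub>\<infinity>x. f n x)"
      using that sum nonneg by (auto intro!: finite_sum_le_infsum)
  qed
  have "0 \<le> l x" for x
    using lim[of x] nonneg by (intro LIMSEQ_le_const) auto
  then show summ: "l summable_on UNIV"
    using fin by (intro nonneg_bdd_above_summable_on) (auto simp: bdd_above_def)
  show "(\<Sum>\<^sub>\<infinity>x. l x) \<le> L"
    by (rule infsum_le_finite_sums[OF summ fin])
qed

context
  fixes w :: "'a \<Rightarrow> real"
  assumes w_nonneg: "\<And>x. 0 \<le> w x"
begin

lemma weighted_l2_mult_summable:
  assumes "f \<in> weighted_l2 w" "g \<in> weighted_l2 w"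
  shows "(\<lambda>x. w x * f x * g x) summable_on UNIV"
proof (rule summable_on_comparison_real)
  show "(\<lambda>x. w x * (f x)\<^sup>2 + w x * (g x)\<^sup>2) summable_on UNIV"
    using assms by (intro summable_on_add) (auto simp: weighted_l2_def)
  show "\<bar>w x * f x * g x\<bar> \<le> w x * (f x)\<^sup>2 + w x * (g x)\<^sup>2" for x
  proof -
    have "2 * \<bar>f x * g x\<bar> \<le> (f x)\<^sup>2 + (g x)\<^sup>2"
      using sum_squares_bound[of "\<bar>f x\<bar>" "\<bar>g x\<bar>"] by (simp add: abs_mult)
    then have "\<bar>f x * g x\<bar> \<le> (f x)\<^sup>2 + (g x)\<^sup>2"
      using abs_ge_zero[of "f x * g x"] by linarith
    then have "w x * \<bar>f x * g x\<bar> \<le> w x * ((f x)\<^sup>2 + (g x)\<^sup>2)"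
      using w_nonneg by (rule mult_left_mono)
    then show ?thesis
      using w_nonneg[of x] by (simp add: abs_mult algebra_simps)
  qed
qed

lemma weighted_l2_scale:
  assumes "f \<in> weighted_l2 w"
  shows "(\<lambda>x. c * f x) \<in> weighted_l2 w"
proof -
  have "(\<lambda>x. c\<^sup>2 * (w x * (f x)\<^sup>2)) summable_on UNIV"
    using assms by (intro summable_on_cmult_right) (simp add: weighted_l2_def)
  moreover have "(\<lambda>x. c\<^sup>2 * (w x * (f x)\<^sup>2)) = (\<lambda>x. w x * (c * f x)\<^sup>2)"
    by (simp add: fun_eq_iff power_mult_distrib)
  ultimately show ?thesis
    by (simp add: weighted_l2_def)
qed

lemma weighted_l2_add:
  assumes "f \<in> weighted_l2 w" "g \<in> weighted_l2 w"
  shows "(\<lambda>x. f x + g x) \<in> weighted_l2 w"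
proof -
  have "(\<lambda>x. w x * (f x)\<^sup>2 + 2 * (w x * f x * g x) + w x * (g x)\<^sup>2) summable_on UNIV"
    using assms weighted_l2_mult_summable[OF assms]
    by (intro summable_on_add summable_on_cmult_right) (auto simp: weighted_l2_def)
  moreover have "(\<lambda>x. w x * (f x)\<^sup>2 + 2 * (w x * f x * g x) + w x * (g x)\<^sup>2) =
      (\<lambda>x. w x * (f x + g x)\<^sup>2)"
    by (simp add: fun_eq_iff power2_sum algebra_simps)
  ultimately show ?thesis
    by (simp add: weighted_l2_def)
qed

lemma weighted_inner_add_left:
  assumes "f \<in> weighted_l2 w" "g \<in> weighted_l2 w" "h \<in> weighted_l2 w"
  shows "weighted_inner w (\<lambda>x. f x + g x) h = weighted_inner w f h + weighted_inner w g h"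
  unfolding weighted_inner_def
  using infsum_add[OF weighted_l2_mult_summable[OF assms(1,3)] weighted_l2_mult_summable[OF assms(2,3)]]
  by (simp add: distrib_left distrib_right)

lemma weighted_inner_scale_left: "weighted_inner w (\<lambda>x. c * f x) g = c * weighted_inner w f g"
  by (simp add: weighted_inner_def infsum_cmult_right'[symmetric] mult.left_commute mult.assoc)

lemma weighted_inner_self_nonneg: "0 \<le> weighted_inner w f f"
  unfolding weighted_inner_def using w_nonneg by (intro infsum_nonneg) (simp add: mult.assoc)

end

text \<open>Gaussian elimination by induction on the equations: a nonzero coefficient
  \<open>a i j0\<close> is used to remove the unknown \<open>j0\<close>, which leaves one equation
  and one unknown fewer.\<close>

lemma exists_nontrivial_solution:
  fixes a :: "'i \<Rightarrow> 'j \<Rightarrow> real"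
  assumes "finite I" "finite J" "card I < card J"
  shows "\<exists>c. (\<exists>j\<in>J. c j \<noteq> 0) \<and> (\<forall>i\<in>I. (\<Sum>j\<in>J. a i j * c j) = 0)"
  using assms
proof (induction I arbitrary: J a rule: finite_induct)
  case empty
  then have "J \<noteq> {}" by auto
  then show ?case by (intro exI[of _ "\<lambda>_. 1"]) auto
next
  case (insert i I)
  show ?case
  proof (cases "\<exists>j\<in>J. a i j \<noteq> 0")
    case False
    then show ?thesis
      using insert.IH[of J a] insert.hyps insert.prems by auto
  next
    case True
    then obtain j0 where j0: "j0 \<in> J" "a i j0 \<noteq> 0" by auto
    define J' where "J' = J - {j0}"
    have J': "finite J'" "card I < card J'" "j0 \<notin> J'" "J = Set.insert j0 J'"
      using insert.hyps insert.prems j0 by (auto simp: J'_def)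
    obtain c where c: "\<exists>j\<in>J'. c j \<noteq> 0"
      "\<And>k. k \<in> I \<Longrightarrow> (\<Sum>j\<in>J'. (a k j - a k j0 * a i j / a i j0) * c j) = 0"
      using insert.IH[OF J'(1,2), of "\<lambda>k j. a k j - a k j0 * a i j / a i j0"] by blast
    \<comment> \<open>The value at \<open>j0\<close> is the one that solves equation
      \<open>i\<close>; the other equations then reduce to the eliminated system.\<close>
    define d where "d = c(j0 := - (\<Sum>j\<in>J'. a i j * c j) / a i j0)"
    have elim: "(\<Sum>j\<in>J. a k j * d j) =
        (\<Sum>j\<in>J'. a k j * c j) - a k j0 / a i j0 * (\<Sum>j\<in>J'. a i j * c j)" for k
    proof -
      have "(\<Sum>j\<in>J'. a k j * d j) = (\<Sum>j\<in>J'. a k j * c j)"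
        using J'(3) by (intro sum.cong) (auto simp: d_def)
      then have "(\<Sum>j\<in>J. a k j * d j) = a k j0 * d j0 + (\<Sum>j\<in>J'. a k j * c j)"
        unfolding J'(4) using J'(1,3) by simp
      then show ?thesis
        by (simp add: d_def)
    qed
    have "(\<Sum>j\<in>J. a k j * d j) = 0" if "k \<in> Set.insert i I" for k
    proof (cases "k = i")
      case True
      then show ?thesis using j0 unfolding elim by simp
    next
      case False
      then have "k \<in> I" using that by simp
      have "(\<Sum>j\<in>J'. (a k j - a k j0 * a i j / a i j0) * c j) =
          (\<Sum>j\<in>J'. a k j * c j) - a k j0 / a i j0 * (\<Sum>j\<in>J'. a i j * c j)"
        unfolding sum_distrib_left sum_subtractf[symmetric]
        by (intro sum.cong refl) (simp add: algebra_simps)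
      then show ?thesis
        using c(2)[OF \<open>k \<in> I\<close>] elim by simp
    qed
    moreover have "\<exists>j\<in>J. d j \<noteq> 0"
      using c(1) J'(3,4) by (auto simp: d_def)
    ultimately show ?thesis by blast
  qed
qed

text \<open>The recursion carries the set of elements chosen so far, so each choice may depend on
  all earlier ones although \<open>rec_nat\<close> sees only the previous stage.\<close>

lemma iterated_choice:
  assumes "\<And>S. S \<subseteq> V \<Longrightarrow> \<exists>u\<in>V. P S u"
  shows "\<exists>e. \<forall>n::nat. e n \<in> V \<and> P (e ` {..<n}) (e n)"
proof -
  obtain G where G: "\<And>S. S \<subseteq> V \<Longrightarrow> G S \<in> V \<and> P S (G S)"
    using assms by metis
  define T where "T = rec_nat {} (\<lambda>_ S. insert (G S) S)"
  have T: "T n \<subseteq> V" for n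
    by (induction n) (auto simp: T_def G)
  have T_eq: "(\<lambda>k. G (T k)) ` {..<n} = T n" for n
    by (induction n) (auto simp: T_def lessThan_Suc)
  have "G (T n) \<in> V \<and> P ((\<lambda>k. G (T k)) ` {..<n}) (G (T n))" for n
    unfolding T_eq using G[OF T] .
  then show ?thesis
    by (intro exI[of _ "\<lambda>k. G (T k)"]) simp
qed

text \<open>Makes best constants usable as actual constants: dividing by \<open>e\<close> turns
  \<open>t / e\<close> into a lower bound of the admissible ones.\<close>

lemma le_Inf_ereal_mult:
  fixes A :: "ereal set" and e :: real
  assumes A: "\<And>a. a \<in> A \<Longrightarrow> \<exists>r. a = ereal r \<and> t \<le> r * e" and e: "0 \<le> e"
    and Inf: "Inf A = ereal s"
  shows "t \<le> s * e"
proof (cases "e = 0")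
  case True
  \<comment> \<open>The infimum of the empty set is \<infinity>, so a finite infimum provides an
    element, whose size does not matter when \<open>e = 0\<close>.\<close>
  have "A \<noteq> {}" using Inf by (auto simp: top_ereal_def)
  then show ?thesis using A True by fastforce
next
  case False
  have "ereal (t / e) \<le> Inf A"
  proof (rule Inf_greatest)
    fix a assume "a \<in> A"
    then show "ereal (t / e) \<le> a"
      using A[of a] False e by (auto simp: divide_simps)
  qed
  then show ?thesis
    using False e by (simp add: Inf divide_simps)
qed

subsection \<open>The energy form of a graph with a Poincare inequality\<close>

locale poincare_graph =
  fixes b :: "'x::countable \<Rightarrow> 'x \<Rightarrow> real" and M :: "'x measure"
  assumes graph: "weighted_graph b"
    and finite_M: "finite_measure M"
    and full_M: "full_support_measure M"
    and poincare_finite: "poincare_const b < \<infinity>"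
begin

abbreviation m :: "'x \<Rightarrow> real" where "m x \<equiv> measure M {x}"
abbreviation \<D> :: "('x \<Rightarrow> real) set" where "\<D> \<equiv> dirichlet_space b"
abbreviation \<E> :: "('x \<Rightarrow> real) \<Rightarrow> ('x \<Rightarrow> real) \<Rightarrow> real" where "\<E> \<equiv> energy b"
abbreviation ip :: "('x \<Rightarrow> real) \<Rightarrow> ('x \<Rightarrow> real) \<Rightarrow> real" where "ip \<equiv> ell2_inner M"

definition grad :: "('x \<Rightarrow> real) \<Rightarrow> 'x \<times> 'x \<Rightarrow> real" where
  "grad f = (\<lambda>(x, y). f x - f y)"

definition cP where "cP = real_of_ereal (poincare_const b)"

lemma sets_M: "A \<in> sets M"
  using full_M by (simp add: full_support_measure_def)

lemma m_pos: "0 < m x"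
proof -
  have "0 < emeasure M {x}"
    using full_M by (simp add: full_support_measure_def)
  then show ?thesis
    by (simp add: finite_measure.emeasure_eq_measure[OF finite_M])
qed

lemma sum_m_le:
  assumes "finite S" "S \<subseteq> A"
  shows "sum m S \<le> measure M A"
proof -
  have "sum m S = measure M S"
    using finite_measure.finite_measure_eq_sum_singleton[OF finite_M assms(1), of] sets_M by simp
  also have "\<dots> \<le> measure M A"
    using finite_measure.finite_measure_mono[OF finite_M assms(2) sets_M] .
  finally show ?thesis .
qed

lemma m_indicator:
  shows "(\<lambda>x. indicator A x * m x) summable_on UNIV"
    and "(\<Sum>\<^sub>\<infinity>x. indicator A x * m x) \<le> measure M A"
proof -
  have fin: "(\<Sum>x\<in>S. indicator A x * m x) \<le> measure M A" if "finite S" for S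
  proof -
    have "(\<Sum>x\<in>S. indicator A x * m x) = sum m (S \<inter> A)"
      using that by (simp add: indicator_def if_distrib sum.If_cases cong: if_cong)
    then show ?thesis
      using sum_m_le[of "S \<inter> A" A] that by simp
  qed
  show summ: "(\<lambda>x. indicator A x * m x) summable_on UNIV"
    using fin by (intro nonneg_bdd_above_summable_on) (auto simp: bdd_above_def)
  show "(\<Sum>\<^sub>\<infinity>x. indicator A x * m x) \<le> measure M A"
    by (rule infsum_le_finite_sums[OF summ fin])
qed

lemma m_summable: "m summable_on UNIV"
  using m_indicator(1)[of UNIV] by simp

lemma b_nonneg: "0 \<le> (case_prod b) p"
  using graph by (auto simp: weighted_graph_def split: prod.split)

lemma dirichlet_iff: "f \<in> \<D> \<longleftrightarrow> grad f \<in> weighted_l2 (case_prod b)"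
  by (simp add: dirichlet_space_def weighted_l2_def grad_def case_prod_unfold)

lemma energy_eq: "\<E> f g = (1/2) * weighted_inner (case_prod b) (grad f) (grad g)"
  by (simp add: energy_def weighted_inner_def grad_def case_prod_unfold)

lemma ell2_eq: "ell2 M = weighted_l2 m"
  by (simp add: ell2_def weighted_l2_def mult.commute)

lemma ip_eq: "ip f g = weighted_inner m f g"
  by (simp add: ell2_inner_def weighted_inner_def mult_ac)

lemma grad_add: "grad (\<lambda>x. f x + g x) = (\<lambda>p. grad f p + grad g p)"
  by (auto simp: grad_def)

lemma grad_scale: "grad (\<lambda>x. a * f x) = (\<lambda>p. a * grad f p)"
  by (auto simp: grad_def algebra_simps)

lemma grad_const: "grad (\<lambda>x. a) = (\<lambda>p. 0)"
  by (auto simp: grad_def)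

lemma D_add: "f \<in> \<D> \<Longrightarrow> g \<in> \<D> \<Longrightarrow> (\<lambda>x. f x + g x) \<in> \<D>"
  by (simp add: dirichlet_iff grad_add weighted_l2_add b_nonneg)

lemma D_scale: "f \<in> \<D> \<Longrightarrow> (\<lambda>x. a * f x) \<in> \<D>"
  by (simp add: dirichlet_iff grad_scale weighted_l2_scale b_nonneg)

lemma D_const: "(\<lambda>x. a) \<in> \<D>"
  by (simp add: dirichlet_iff grad_const weighted_l2_def)

lemma D_diff: "f \<in> \<D> \<Longrightarrow> g \<in> \<D> \<Longrightarrow> (\<lambda>x. f x - g x) \<in> \<D>"
  using D_add[OF _ D_scale[of g "-1"], of f] by simp

lemma D_sum: "(\<And>k. k \<in> S \<Longrightarrow> e k \<in> \<D>) \<Longrightarrow> (\<lambda>x. \<Sum>k\<in>S. a k * e k x) \<in> \<D>"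
  by (induction S rule: infinite_finite_induct) (simp_all add: D_const D_add D_scale)

lemma E_commute: "\<E> f g = \<E> g f"
  by (simp add: energy_eq weighted_inner_commute)

lemma E_add: "f \<in> \<D> \<Longrightarrow> g \<in> \<D> \<Longrightarrow> h \<in> \<D> \<Longrightarrow> \<E> (\<lambda>x. f x + g x) h = \<E> f h + \<E> g h"
  by (simp add: energy_eq dirichlet_iff grad_add weighted_inner_add_left b_nonneg)

lemma E_scale: "\<E> (\<lambda>x. a * f x) h = a * \<E> f h"
  by (simp add: energy_eq grad_scale weighted_inner_scale_left b_nonneg)

lemma E_const: "\<E> (\<lambda>x. a) h = 0"
  by (simp add: energy_eq grad_const weighted_inner_def)

lemma E_nonneg: "0 \<le> \<E> f f"
  by (simp add: energy_eq weighted_inner_self_nonneg b_nonneg)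

lemma E_sum:
  assumes "\<And>k. k \<in> S \<Longrightarrow> e k \<in> \<D>" "h \<in> \<D>"
  shows "\<E> (\<lambda>x. \<Sum>k\<in>S. a k * e k x) h = (\<Sum>k\<in>S. a k * \<E> (e k) h)"
  using assms
  by (induction S rule: infinite_finite_induct) (auto simp: E_const E_add E_scale D_scale D_sum)

section \<open>The Poincare inequality as a pointwise estimate\<close>

lemma poincare_const_eq: "poincare_const b = ereal cP" and cP_nonneg: "0 \<le> cP"
proof -
  have "0 \<le> poincare_const b"
    unfolding poincare_const_def by (rule Inf_greatest) auto
  then show "poincare_const b = ereal cP"
    using poincare_finite by (cases "poincare_const b") (auto simp: cP_def)
  with \<open>0 \<le> poincare_const b\<close> show "0 \<le> cP" by simp
qed

lemma variation_le:
  assumes "(variation_norm f)\<^sup>2 \<le> ereal t"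
  shows "(f x - f y)\<^sup>2 \<le> t"
proof -
  have le: "ereal (f x - f y) \<le> variation_norm f" for x y
    unfolding variation_norm_def
    by (subst ereal_minus(1)[symmetric], rule ereal_minus_mono) (auto intro: SUP_upper INF_lower)
  have "variation_norm f \<noteq> \<infinity>"
    using assms by auto
  moreover have "variation_norm f \<noteq> -\<infinity>"
    using le[of x x] by auto
  ultimately obtain v where v: "variation_norm f = ereal v"
    by (cases "variation_norm f") auto
  have "\<bar>f x - f y\<bar> \<le> v"
    using le[of x y] le[of y x] by (simp add: v)
  then have "(f x - f y)\<^sup>2 \<le> v\<^sup>2"
    using abs_le_square_iff[of "f x - f y" v] by auto
  then show ?thesis
    using assms by (simp add: v)
qed

lemma poincare:
  assumes "f \<in> \<D>"
  shows "(f x - f y)\<^sup>2 \<le> cP * \<E> f f"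
  using assms
  by (intro le_Inf_ereal_mult[OF _ E_nonneg poincare_const_eq[unfolded poincare_const_def]])
    (auto intro: variation_le)

text \<open>The range of \<open>f\<close> lies in an interval of length
  \<open>R = sqrt (cP * \<E> f f)\<close>, and \<open>s\<close> is its midpoint. Squaring the
  distance \<open>R / 2\<close> produces the factor 4 of part (a).\<close>

lemma poincare_midpoint:
  assumes "f \<in> \<D>"
  obtains s where "\<And>x. (f x - s)\<^sup>2 \<le> cP * \<E> f f / 4"
proof
  define R where "R = sqrt (cP * \<E> f f)"
  have R: "\<bar>f x - f y\<bar> \<le> R" for x y
    unfolding R_def using poincare[OF assms] by (intro real_le_rsqrt) simp
  have bdd: "bdd_below (range f)"
  proof (rule bdd_belowI)
    show "f undefined - R \<le> t" if "t \<in> range f" for t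
      using that R[of undefined] by (auto simp: abs_le_iff algebra_simps)
  qed
  fix x
  have "Inf (range f) \<le> f x"
    using bdd by (auto intro: cInf_lower)
  moreover have "f x - R \<le> Inf (range f)"
    using R[of x] by (intro cInf_greatest) (auto simp: abs_le_iff algebra_simps)
  ultimately have "\<bar>f x - (Inf (range f) + R / 2)\<bar> \<le> R / 2"
    by linarith
  then have "(f x - (Inf (range f) + R / 2))\<^sup>2 \<le> (R / 2)\<^sup>2"
    by (metis abs_ge_zero power2_abs power_mono)
  also have "\<dots> = cP * \<E> f f / 4"
    using cP_nonneg E_nonneg by (simp add: R_def power_divide)
  finally show "(f x - (Inf (range f) + R / 2))\<^sup>2 \<le> cP * \<E> f f / 4" .
qed

lemma bounded_ell2:
  assumes "\<And>x. \<bar>f x\<bar> \<le> K"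
  shows "f \<in> ell2 M"
proof -
  have "(\<lambda>x. K\<^sup>2 * m x) summable_on UNIV"
    using m_summable by (rule summable_on_cmult_right)
  moreover have "\<bar>m x * (f x)\<^sup>2\<bar> \<le> K\<^sup>2 * m x" for x
    using power_mono[OF assms abs_ge_zero, of x 2]
    by (simp add: abs_mult mult.commute[of "m x"] mult_right_mono)
  ultimately show ?thesis
    unfolding ell2_eq weighted_l2_def by (auto intro: summable_on_comparison_real)
qed

lemma D_bound:
  assumes "f \<in> \<D>"
  shows "\<bar>f x\<bar> \<le> \<bar>f y\<bar> + sqrt (cP * \<E> f f)"
proof -
  have "\<bar>f x - f y\<bar> \<le> sqrt (cP * \<E> f f)"
    using poincare[OF assms] by (intro real_le_rsqrt) simp
  then show ?thesis by simp
qed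

lemma D_ell2: "f \<in> \<D> \<Longrightarrow> f \<in> ell2 M"
  using D_bound by (rule bounded_ell2)

text \<open>Finite energy implies boundedness by the Poincare inequality, and bounded functions are
  square summable because \<open>M\<close> is finite.\<close>

lemma form_domain_eq: "form_domain b M = \<D>"
  using D_ell2 by (auto simp: form_domain_def)

section \<open>The inner product of \<open>ell2 M\<close>\<close>

lemma ip_commute: "ip f g = ip g f"
  by (simp add: ip_eq weighted_inner_commute)

lemma ip_add: "f \<in> ell2 M \<Longrightarrow> g \<in> ell2 M \<Longrightarrow> h \<in> ell2 M \<Longrightarrow>
    ip (\<lambda>x. f x + g x) h = ip f h + ip g h"
  by (simp add: ip_eq ell2_eq weighted_inner_add_left)

lemma ell2_add: "f \<in> ell2 M \<Longrightarrow> g \<in> ell2 M \<Longrightarrow> (\<lambda>x. f x + g x) \<in> ell2 M"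
  by (simp add: ell2_eq weighted_l2_add)

lemma ell2_scale: "f \<in> ell2 M \<Longrightarrow> (\<lambda>x. a * f x) \<in> ell2 M"
  by (simp add: ell2_eq weighted_l2_scale)

lemma ip_scale: "ip (\<lambda>x. a * f x) h = a * ip f h"
  by (simp add: ip_eq weighted_inner_scale_left)

lemma ip_zero: "ip (\<lambda>x. 0) h = 0"
  by (simp add: ip_eq weighted_inner_def)

lemma ip_nonneg: "0 \<le> ip f f"
  by (simp add: ip_eq weighted_inner_self_nonneg)

lemma ip_sum:
  assumes "\<And>k. k \<in> S \<Longrightarrow> e k \<in> \<D>" "h \<in> \<D>"
  shows "ip (\<lambda>x. \<Sum>k\<in>S. a k * e k x) h = (\<Sum>k\<in>S. a k * ip (e k) h)"
  using assms
  by (induction S rule: infinite_finite_induct)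
    (auto simp: ip_zero ip_add ip_scale D_scale D_sum D_ell2)

lemma ip_diff:
  assumes "f \<in> \<D>" "g \<in> \<D>" "h \<in> \<D>"
  shows "ip (\<lambda>x. f x - g x) h = ip f h - ip g h"
  using ip_add[of f "\<lambda>x. -1 * g x" h] assms ip_scale[of "-1" g h] D_scale[of g "-1"]
  by (simp add: D_ell2)

lemma point_le_ip:
  assumes "f \<in> ell2 M"
  shows "(f x)\<^sup>2 * m x \<le> ip f f"
proof -
  have "(\<lambda>x. m x * f x * f x) summable_on UNIV"
    using assms by (simp add: ell2_eq weighted_l2_mult_summable)
  moreover have "0 \<le> m z * f z * f z" for z
    by (simp add: mult.assoc)
  ultimately have "(\<Sum>z\<in>{x}. m z * f z * f z) \<le> ip f f"
    unfolding ip_eq weighted_inner_def by (intro finite_sum_le_infsum) auto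
  then show ?thesis
    by (simp add: power2_eq_square mult_ac)
qed

lemma ip_pos:
  assumes "f \<in> ell2 M" "f \<noteq> (\<lambda>x. 0)"
  shows "0 < ip f f"
proof -
  obtain x where "f x \<noteq> 0"
    using assms(2) by auto
  then have "0 < (f x)\<^sup>2 * m x"
    using m_pos by simp
  then show ?thesis
    using point_le_ip[OF assms(1), of x] by simp
qed

text \<open>Popoviciu's argument: off \<open>F\<close> the bound gives
  \<open>f x * f x \<le> 2 * s * f x + K\<close>, on \<open>F\<close> everything vanishes, and the
  linear term sums to zero by the condition on \<open>s\<close>. That condition covers both
  orthogonality to the constants with any \<open>s\<close>, and \<open>s = 0\<close>.\<close>

lemma ip_self_le:
  assumes f: "f \<in> \<D>" and zero: "\<And>x. x \<in> F \<Longrightarrow> f x = 0"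
    and bound: "\<And>x. (f x - s)\<^sup>2 \<le> K" and s: "s * ip f (\<lambda>_. 1) = 0"
  shows "ip f f \<le> K * measure M (UNIV - F)"
proof -
  let ?I = "indicator (UNIV - F) :: 'x \<Rightarrow> real"
  have K: "0 \<le> K"
    using order_trans[OF zero_le_power2 bound] .
  have s1: "(\<lambda>x. 2 * s * (m x * f x * 1)) summable_on UNIV"
    using weighted_l2_mult_summable[of m f "\<lambda>_. 1"] f D_const[of 1]
    by (intro summable_on_cmult_right) (simp add: ell2_eq[symmetric] D_ell2)
  have s2: "(\<lambda>x. K * (?I x * m x)) summable_on UNIV"
    by (intro summable_on_cmult_right m_indicator)
  have "ip f f = (\<Sum>\<^sub>\<infinity>x. m x * f x * f x)"
    by (simp add: ip_eq weighted_inner_def)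
  also have "\<dots> \<le> (\<Sum>\<^sub>\<infinity>x. 2 * s * (m x * f x * 1) + K * (?I x * m x))"
  proof (rule infsum_mono)
    show "(\<lambda>x. m x * f x * f x) summable_on UNIV"
      using f by (simp add: weighted_l2_mult_summable ell2_eq[symmetric] D_ell2)
    show "(\<lambda>x. 2 * s * (m x * f x * 1) + K * (?I x * m x)) summable_on UNIV"
      by (intro summable_on_add s1 s2)
    fix x
    have "f x * f x \<le> 2 * s * f x + K * ?I x"
    proof (cases "x \<in> F")
      case False
      have "(f x - s)\<^sup>2 = f x * f x - 2 * s * f x + s\<^sup>2"
        by (simp add: power2_eq_square algebra_simps)
      then have "f x * f x \<le> 2 * s * f x + K"
        using bound[of x] zero_le_power2[of s] by linarith
      then show ?thesis
        using False by simp
    qed (simp add: zero)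
    then have "m x * (f x * f x) \<le> m x * (2 * s * f x + K * ?I x)"
      by (rule mult_left_mono) simp
    then show "m x * f x * f x \<le> 2 * s * (m x * f x * 1) + K * (?I x * m x)"
      by (simp add: algebra_simps)
  qed
  also have "\<dots> = 2 * (s * ip f (\<lambda>_. 1)) + K * (\<Sum>\<^sub>\<infinity>x. ?I x * m x)"
    by (subst infsum_add[OF s1 s2]) (simp add: infsum_cmult_right' ip_eq weighted_inner_def mult.assoc)
  also have "\<dots> \<le> K * measure M (UNIV - F)"
    unfolding s using K m_indicator(2)[of "UNIV - F"] by (simp add: mult_left_mono del: mult_eq_0_iff)
  finally show ?thesis .
qed

text \<open>Inner products converge because constants are summable majorants for the finite measure.
  For the energy only Fatou is available, so the limit \<open>L\<close> of the energies is kept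
  apart from \<open>\<E> u u\<close>.\<close>

lemma compactness:
  assumes f: "\<And>k::nat. f k \<in> \<D>" and E: "\<And>k. \<E> (f k) (f k) \<le> C" and ip: "\<And>k. ip (f k) (f k) \<le> C"
  obtains r u L where "strict_mono r" "u \<in> \<D>"
    "\<And>g. g \<in> \<D> \<Longrightarrow> (\<lambda>k. ip (f (r k)) g) \<longlonglongrightarrow> ip u g"
    "(\<lambda>k. ip (f (r k)) (f (r k))) \<longlonglongrightarrow> ip u u"
    "(\<lambda>k. \<E> (f (r k)) (f (r k))) \<longlonglongrightarrow> L" "\<E> u u \<le> L"
proof -
  define y :: 'x where "y = undefined"
  \<comment> \<open>The first summand bounds the functions at the reference vertex \<open>y\<close>,
    the second bounds their oscillation.\<close>
  define K where "K = sqrt (C / m y) + sqrt (cP * C)"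
  have fK: "\<bar>f k x\<bar> \<le> K" for k x
  proof -
    have "(f k y)\<^sup>2 * m y \<le> C"
      using point_le_ip[OF D_ell2[OF f], of k y] ip[of k] by linarith
    then have "\<bar>f k y\<bar> \<le> sqrt (C / m y)"
      using m_pos[of y] by (intro real_le_rsqrt) (simp add: pos_le_divide_eq)
    moreover have "sqrt (cP * \<E> (f k) (f k)) \<le> sqrt (cP * C)"
      using E cP_nonneg by (intro real_sqrt_le_mono mult_left_mono)
    ultimately show ?thesis
      using D_bound[OF f, of k x y] unfolding K_def by linarith
  qed
  \<comment> \<open>The extra coordinate \<open>None\<close> makes the energies converge along the same subsequence.\<close>
  define F where "F k z = (case z of None \<Rightarrow> \<E> (f k) (f k) | Some x \<Rightarrow> f k x)" for k z
  have "norm (F k z) \<le> max C K" for k z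
    using fK[of k] E[of k] E_nonneg[of "f k"]
    by (auto simp: F_def split: option.split intro: le_max_iff_disj[THEN iffD2])
  then obtain r where r: "strict_mono r" and conv: "\<And>z. \<exists>l. (\<lambda>k. F (r k) z) \<longlonglongrightarrow> l"
    using function_convergent_subsequence[of UNIV F "max C K"] by (metis countableI_type UNIV_I)
  obtain L where L: "(\<lambda>k. \<E> (f (r k)) (f (r k))) \<longlonglongrightarrow> L"
    using conv[of None] by (auto simp: F_def)
  have "\<exists>l. (\<lambda>k. f (r k) x) \<longlonglongrightarrow> l" for x
    using conv[of "Some x"] by (auto simp: F_def)
  then obtain u where u: "\<And>x. (\<lambda>k. f (r k) x) \<longlonglongrightarrow> u x"
    by metis
  let ?w = "case_prod b"
  let ?e = "\<lambda>h p. ?w p * grad h p * grad h p"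
  have summ: "?e (f k) summable_on UNIV" for k
    using f by (simp add: dirichlet_iff weighted_l2_mult_summable b_nonneg)
  have lim: "(\<lambda>k. ?e (f (r k)) p) \<longlonglongrightarrow> ?e u p" for p
    unfolding grad_def case_prod_unfold by (intro tendsto_intros u)
  have L2: "(\<lambda>k. infsum (?e (f (r k))) UNIV) \<longlonglongrightarrow> 2 * L"
    using tendsto_mult_left[OF L, of 2] by (simp add: energy_eq weighted_inner_def)
  have nonneg: "0 \<le> ?e h p" for h p
    using b_nonneg[of p] by (simp add: mult.assoc)
  have "?e u summable_on UNIV" "infsum (?e u) UNIV \<le> 2 * L"
    using fatou_infsum[of "\<lambda>k. ?e (f (r k))", OF summ nonneg lim L2] by auto
  then have uD: "u \<in> \<D>" and uE: "\<E> u u \<le> L"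
    by (simp_all add: dirichlet_iff weighted_l2_def energy_eq weighted_inner_def power2_eq_square mult.assoc)
  \<comment> \<open>The second argument varies with \<open>k\<close>, so that one statement yields
    the limits against a fixed function and those of the norms.\<close>
  have ipconv: "(\<lambda>k. ip (f (r k)) (g k)) \<longlonglongrightarrow> ip u h"
    if g: "\<And>k x. \<bar>g k x\<bar> \<le> G" "\<And>x. (\<lambda>k. g k x) \<longlonglongrightarrow> h x" for g h G
    unfolding ell2_inner_def
  proof (rule infsum_dominated_convergence)
    show "(\<lambda>x. (K * G) * m x) summable_on UNIV"
      using m_summable by (rule summable_on_cmult_right)
    have "0 \<le> K"
      using order_trans[OF abs_ge_zero fK] .
    then show "\<bar>f (r k) x * g k x * m x\<bar> \<le> (K * G) * m x" for k x
      using fK g(1) by (auto simp: abs_mult intro!: mult_right_mono mult_mono)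
    show "(\<lambda>k. f (r k) x * g k x * m x) \<longlonglongrightarrow> u x * h x * m x" for x
      by (intro tendsto_intros u g)
  qed
  show thesis
  proof
    show "(\<lambda>k. ip (f (r k)) g) \<longlonglongrightarrow> ip u g" if "g \<in> \<D>" for g
      using D_bound[OF that] by (rule ipconv) auto
    show "(\<lambda>k. ip (f (r k)) (f (r k))) \<longlonglongrightarrow> ip u u"
      using fK u by (rule ipconv)
  qed (fact r uD L uE)+
qed

subsection \<open>Spectral decomposition\<close>

lemma E_line:
  assumes "f \<in> \<D>" "g \<in> \<D>"
  shows "\<E> (\<lambda>x. f x + s * g x) (\<lambda>x. f x + s * g x) = \<E> f f + 2 * s * \<E> f g + s\<^sup>2 * \<E> g g"
proof -
  let ?h = "\<lambda>x. f x + s * g x"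
  have left: "\<E> ?h k = \<E> f k + s * \<E> g k" if "k \<in> \<D>" for k
    using assms that by (simp add: E_add E_scale D_scale)
  have "\<E> ?h ?h = \<E> ?h f + s * \<E> ?h g"
    using left[of ?h] assms by (simp add: D_add D_scale E_commute[of f ?h] E_commute[of g ?h])
  then show ?thesis
    using assms E_commute[of g f] by (simp add: left power2_eq_square algebra_simps)
qed

lemma ip_line:
  assumes "f \<in> ell2 M" "g \<in> ell2 M"
  shows "ip (\<lambda>x. f x + s * g x) (\<lambda>x. f x + s * g x) = ip f f + 2 * s * ip f g + s\<^sup>2 * ip g g"
proof -
  let ?h = "\<lambda>x. f x + s * g x"
  have left: "ip ?h k = ip f k + s * ip g k" if "k \<in> ell2 M" for k
    using assms that by (simp add: ip_add ip_scale ell2_scale)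
  have "ip ?h ?h = ip ?h f + s * ip ?h g"
    using left[of ?h] assms by (simp add: ell2_add ell2_scale ip_commute[of f ?h] ip_commute[of g ?h])
  then show ?thesis
    using assms ip_commute[of g f] by (simp add: left power2_eq_square algebra_simps)
qed

text \<open>A normalized minimizing sequence has a limit point by \<open>compactness\<close>. Norm
  and orthogonality survive because inner products converge, and the energy does not exceed the
  infimum. The function \<open>f\<close> guarantees that there are competitors.\<close>

lemma rayleigh_minimizer:
  assumes S: "S \<subseteq> \<D>" and f: "f \<in> \<D>" "f \<noteq> (\<lambda>x. 0)" "\<forall>g\<in>S. ip f g = 0"
  obtains u where "u \<in> \<D>" "ip u u = 1" "\<forall>g\<in>S. ip u g = 0"
    "\<And>h. h \<in> \<D> \<Longrightarrow> \<forall>g\<in>S. ip h g = 0 \<Longrightarrow> \<E> u u * ip h h \<le> \<E> h h"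
proof -
  define A where "A = {\<E> h h |h. h \<in> \<D> \<and> ip h h = 1 \<and> (\<forall>g\<in>S. ip h g = 0)}"
  have normalized: "\<E> h h / ip h h \<in> A" if "h \<in> \<D>" "\<forall>g\<in>S. ip h g = 0" "0 < ip h h" for h
  proof -
    define a where "a = 1 / sqrt (ip h h)"
    have a: "a * a = 1 / ip h h"
      using that by (simp add: a_def)
    let ?h = "\<lambda>x. a * h x"
    have "ip ?h ?h = a * a * ip h h" "\<E> ?h ?h = a * a * \<E> h h"
      by (simp_all add: ip_scale E_scale ip_commute[of h ?h] E_commute[of h ?h])
    then have "ip ?h ?h = 1" "\<E> ?h ?h = \<E> h h / ip h h"
      using that a by simp_all
    moreover have "\<forall>g\<in>S. ip ?h g = 0"
      using that by (simp add: ip_scale)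
    ultimately show ?thesis
      unfolding A_def using D_scale[OF that(1), of a] by force
  qed
  have ne: "A \<noteq> {}"
    using normalized[OF f(1,3)] ip_pos[OF D_ell2] f by auto
  have bdd: "bdd_below A"
    using E_nonneg by (intro bdd_belowI[of _ 0]) (auto simp: A_def)
  define l where "l = Inf A"
  have "\<exists>h. h \<in> \<D> \<and> ip h h = 1 \<and> (\<forall>g\<in>S. ip h g = 0) \<and> \<E> h h < l + 1 / real (Suc k)" for k
  proof -
    have "Inf A < l + 1 / real (Suc k)"
      by (simp add: l_def)
    then obtain a where "a \<in> A" "a < l + 1 / real (Suc k)"
      using cInf_lessD[OF ne] by blast
    then show ?thesis
      by (auto simp: A_def)
  qed
  then obtain h where h: "\<And>k. h k \<in> \<D>" "\<And>k. ip (h k) (h k) = 1"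
      "\<And>k. \<forall>g\<in>S. ip (h k) g = 0" "\<And>k. \<E> (h k) (h k) < l + 1 / real (Suc k)"
    by metis
  have lower: "l \<le> \<E> (h k) (h k)" for k
    unfolding l_def using h bdd by (intro cInf_lower) (auto simp: A_def)
  have "(\<lambda>k. l + 1 / real (Suc k)) \<longlonglongrightarrow> l"
    using tendsto_add[OF tendsto_const LIMSEQ_Suc[OF lim_inverse_n'], of l] by simp
  then have lim: "(\<lambda>k. \<E> (h k) (h k)) \<longlonglongrightarrow> l"
    by (rule tendsto_sandwich[OF _ _ tendsto_const, rotated 2])
      (simp_all add: lower h(4) less_imp_le del: of_nat_Suc)
  have "\<E> (h k) (h k) \<le> max 1 (l + 1)" "ip (h k) (h k) \<le> max 1 (l + 1)" for k
  proof -
    have "1 / real (Suc k) \<le> 1" by simp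
    then show "\<E> (h k) (h k) \<le> max 1 (l + 1)"
      using h(4)[of k] by linarith
  qed (simp add: h)
  then obtain r u L where u: "strict_mono r" "u \<in> \<D>"
    "\<And>g. g \<in> \<D> \<Longrightarrow> (\<lambda>k. ip (h (r k)) g) \<longlonglongrightarrow> ip u g"
    "(\<lambda>k. ip (h (r k)) (h (r k))) \<longlonglongrightarrow> ip u u"
    "(\<lambda>k. \<E> (h (r k)) (h (r k))) \<longlonglongrightarrow> L" "\<E> u u \<le> L"
    using compactness[of h, OF h(1)] by blast
  show thesis
  proof
    show "u \<in> \<D>" by fact
    show "ip u u = 1"
      using u(4) by (simp add: h(2) LIMSEQ_const_iff)
    show "\<forall>g\<in>S. ip u g = 0"
      using u(3) S h(3) by (force simp: LIMSEQ_const_iff)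
    \<comment> \<open>The subsequence inherits the limit \<open>l\<close> of the minimizing
      sequence.\<close>
    have "L = l"
      using LIMSEQ_subseq_LIMSEQ[OF lim u(1)] u(5) LIMSEQ_unique by (force simp: o_def)
    fix g assume g: "g \<in> \<D>" "\<forall>s\<in>S. ip g s = 0"
    show "\<E> u u * ip g g \<le> \<E> g g"
    proof (cases "ip g g = 0")
      case True
      then show ?thesis by (simp add: E_nonneg)
    next
      case False
      then have pos: "0 < ip g g"
        using ip_nonneg[of g] by simp
      have "l \<le> \<E> g g / ip g g"
        unfolding l_def using normalized[OF g pos] bdd by (rule cInf_lower)
      then have "\<E> u u \<le> \<E> g g / ip g g"
        using u(6) \<open>L = l\<close> by simp
      then show ?thesis
        using pos by (simp add: pos_le_divide_eq)
    qed
  qed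
qed

text \<open>First variation: the difference of the two sides of \<open>min\<close> is a quadratic in
  \<open>s\<close> that is nonnegative and vanishes at \<open>s = 0\<close>, so its linear
  coefficient is zero.\<close>

lemma rayleigh_minimizer_orthogonal:
  assumes u: "u \<in> \<D>" "ip u u = 1" and h: "h \<in> \<D>"
    and min: "\<And>s. \<E> u u * ip (\<lambda>x. u x + s * h x) (\<lambda>x. u x + s * h x)
      \<le> \<E> (\<lambda>x. u x + s * h x) (\<lambda>x. u x + s * h x)"
  shows "\<E> u h = \<E> u u * ip u h"
proof -
  define A where "A = \<E> u h - \<E> u u * ip u h"
  define B where "B = \<E> h h - \<E> u u * ip h h"
  have q: "0 \<le> 2 * s * A + s\<^sup>2 * B" for s
    using min[of s] u h by (simp add: E_line ip_line D_ell2 A_def B_def algebra_simps)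
  \<comment> \<open>A positive upper bound of \<open>B\<close>; testing with
    \<open>s = - A / d\<close> leaves at most \<open>- (A\<^sup>2 / d)\<close>, whatever the sign of
    \<open>B\<close>.\<close>
  define d where "d = \<bar>B\<bar> + 1"
  have d: "0 < d" "B \<le> d" by (auto simp: d_def)
  have "0 \<le> 2 * (- A / d) * A + (- A / d)\<^sup>2 * B"
    by (rule q)
  also have "\<dots> \<le> 2 * (- A / d) * A + (- A / d)\<^sup>2 * d"
    using d by (intro add_left_mono mult_left_mono) auto
  also have "\<dots> = - (A\<^sup>2 / d)"
    using d by (simp add: power2_eq_square divide_simps)
  finally have "A\<^sup>2 \<le> 0"
    using d by (simp add: divide_le_0_iff)
  then show ?thesis
    by (simp add: A_def)
qed

lemma ell2_norm_less: "0 < \<epsilon> \<Longrightarrow> ell2_norm M f < \<epsilon> \<longleftrightarrow> ip f f < \<epsilon>\<^sup>2"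
  using real_sqrt_less_iff[of "ip f f" "\<epsilon>\<^sup>2"] by (simp add: ell2_norm_def del: real_sqrt_less_iff)

text \<open>The index set \<open>I\<close> is an initial segment of the naturals; \<open>n \<notin> I\<close> encodes that
  \<open>e 0, \<dots>, e (n - 1)\<close> already span the form domain, and then \<open>e n = 0\<close>.\<close>

lemma eigenbasis:
  obtains e :: "nat \<Rightarrow> 'x \<Rightarrow> real" and I :: "nat set" and l :: "nat \<Rightarrow> real" where
    "\<And>k. e k \<in> \<D>"
    "\<And>j k. j \<in> I \<Longrightarrow> k \<in> I \<Longrightarrow> ip (e j) (e k) = (if j = k then 1 else 0)"
    "\<And>j k. j \<le> k \<Longrightarrow> k \<in> I \<Longrightarrow> j \<in> I \<and> l j \<le> l k"
    "\<And>k h. h \<in> \<D> \<Longrightarrow> \<E> (e k) h = l k * ip (e k) h"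
    "\<And>f \<epsilon>. f \<in> \<D> \<Longrightarrow> 0 < \<epsilon> \<Longrightarrow>
      \<exists>n. ell2_norm M (\<lambda>x. f x - (\<Sum>k\<in>{k\<in>I. k < n}. ip f (e k) * e k x)) < \<epsilon>"
proof -
  \<comment> \<open>The zero alternative keeps the choice possible once the earlier vectors admit no
    nonzero orthogonal function, so a total sequence results even in finite dimension.\<close>
  define P where "P S u \<longleftrightarrow> (\<forall>g\<in>S. ip u g = 0) \<and>
    (u = (\<lambda>x. 0) \<and> (\<forall>h\<in>\<D>. (\<forall>g\<in>S. ip h g = 0) \<longrightarrow> h = (\<lambda>x. 0)) \<or>
     ip u u = 1 \<and> (\<forall>h\<in>\<D>. (\<forall>g\<in>S. ip h g = 0) \<longrightarrow> \<E> u u * ip h h \<le> \<E> h h))" for S u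
  have "\<exists>u\<in>\<D>. P S u" if S: "S \<subseteq> \<D>" for S
  proof (cases "\<forall>h\<in>\<D>. (\<forall>g\<in>S. ip h g = 0) \<longrightarrow> h = (\<lambda>x. 0)")
    case True
    then have "P S (\<lambda>x. 0)"
      by (simp add: P_def ip_zero)
    then show ?thesis
      using D_const by blast
  next
    case False
    then obtain f where f: "f \<in> \<D>" "f \<noteq> (\<lambda>x. 0)" "\<forall>g\<in>S. ip f g = 0"
      by blast
    obtain u where "u \<in> \<D>" "ip u u = 1" "\<forall>g\<in>S. ip u g = 0"
      "\<And>h. h \<in> \<D> \<Longrightarrow> \<forall>g\<in>S. ip h g = 0 \<Longrightarrow> \<E> u u * ip h h \<le> \<E> h h"
      using rayleigh_minimizer[OF S f] by blast
    then have "P S u"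
      by (simp add: P_def)
    then show ?thesis
      using \<open>u \<in> \<D>\<close> by blast
  qed
  then obtain e where e: "\<And>n::nat. e n \<in> \<D>" and Pe: "\<And>n. P (e ` {..<n}) (e n)"
    using iterated_choice[of \<D> P] by auto
  define I where "I = {n. e n \<noteq> (\<lambda>x. 0)}"
  define l where "l n = \<E> (e n) (e n)" for n
  have orth_less: "ip (e n) (e k) = 0" if "k < n" for n k
    using Pe[of n] that by (auto simp: P_def)
  have orth: "ip (e j) (e k) = 0" if "j \<noteq> k" for j k
    using orth_less[of j k] orth_less[of k j] that ip_commute[of "e j" "e k"] by (cases "j < k") auto
  have unit: "ip (e n) (e n) = 1" if "n \<in> I" for n
    using Pe[of n] that by (auto simp: P_def I_def)
  have zero: "ip f (e n) = 0" if "n \<notin> I" for n f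
    using that ip_zero[of f] by (simp add: I_def ip_commute[of f])
  have min: "l n * ip h h \<le> \<E> h h"
    if "n \<in> I" "h \<in> \<D>" "\<And>k. k < n \<Longrightarrow> ip h (e k) = 0" for n h
    using Pe[of n] that by (auto simp: P_def I_def l_def)
  have exhausted: "h = (\<lambda>x. 0)"
    if "n \<notin> I" "h \<in> \<D>" "\<And>k. k < n \<Longrightarrow> ip h (e k) = 0" for n h
    using Pe[of n] that by (auto simp: P_def I_def ip_zero)
  \<comment> \<open>The vector \<open>e k\<close> is orthogonal to all predecessors of
    \<open>e j\<close>. If \<open>e j\<close> were zero, \<open>e k\<close> would vanish by
    exhaustion; otherwise \<open>e k\<close> is a competitor in the minimization that produced
    \<open>e j\<close>.\<close>
  have mono: "j \<in> I \<and> l j \<le> l k" if "j \<le> k" "k \<in> I" for j k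
  proof
    show "j \<in> I"
      using exhausted[of j "e k"] orth_less[of _ k] that e by (force simp: I_def)
    then show "l j \<le> l k"
      using min[of j "e k"] orth_less[of _ k] that e unit[OF that(2)] by (simp add: l_def)
  qed
  define r where "r f n = (\<lambda>x. f x - (\<Sum>k<n. ip f (e k) * e k x))" for f n
  have sum_D: "(\<lambda>x. \<Sum>k<n. a k * e k x) \<in> \<D>" for n a
    using e by (intro D_sum)
  have r_D: "r f n \<in> \<D>" if "f \<in> \<D>" for f n
    unfolding r_def using that sum_D by (rule D_diff)
  have r_orth: "ip (r f n) (e j) = 0" if "f \<in> \<D>" "j < n" for f n j
  proof -
    have "(\<Sum>k<n. ip f (e k) * ip (e k) (e j)) = (\<Sum>k<n. if k = j then ip f (e j) else 0)"
      using orth unit zero by (intro sum.cong refl) fastforce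
    then show ?thesis
      using that e by (simp add: r_def ip_diff ip_sum sum_D)
  qed
  have split: "(\<lambda>x. r f n x + (\<Sum>k<n. ip f (e k) * e k x)) = f" for f n
    by (simp add: r_def)
  \<comment> \<open>Minimality gives the equation only against functions orthogonal to
    \<open>e 0, ..., e (n - 1)\<close>. For general \<open>h\<close> the remaining part is the
    projection to these vectors, where both sides vanish: the energy by the induction hypothesis,
    the inner product by orthogonality.\<close>
  have eigen: "\<E> (e n) h = l n * ip (e n) h" if "h \<in> \<D>" for n h
    using that
  proof (induction n arbitrary: h rule: less_induct)
    case (less n)
    show ?case
    proof (cases "n \<in> I")
      case False
      then show ?thesis
        using E_const[of 0 h] ip_zero[of h] by (simp add: I_def)
    next
      case True
      have perp: "\<E> (e n) (r h n) = l n * ip (e n) (r h n)"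
        unfolding l_def
      proof (rule rayleigh_minimizer_orthogonal)
        fix s
        let ?g = "\<lambda>x. e n x + s * r h n x"
        have "?g \<in> \<D>"
          by (intro D_add D_scale e r_D less.prems)
        moreover have "ip ?g (e k) = 0" if "k < n" for k
          using that e less.prems
          by (simp add: ip_add ip_scale r_orth orth_less D_ell2 D_scale r_D)
        ultimately show "\<E> (e n) (e n) * ip ?g ?g \<le> \<E> ?g ?g"
          using min[OF True] by (simp add: l_def)
      qed (use e unit[OF True] r_D less.prems in auto)
      have "\<E> (e k) (e n) = 0" if "k < n" for k
        using less.IH[OF that e] orth that by simp
      then have "\<E> (\<lambda>x. \<Sum>k<n. ip h (e k) * e k x) (e n) = 0"
        using e by (simp add: E_sum)
      moreover have "ip (\<lambda>x. \<Sum>k<n. ip h (e k) * e k x) (e n) = 0"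
        using e orth by (simp add: ip_sum)
      moreover have "\<E> h (e n) = \<E> (r h n) (e n) + \<E> (\<lambda>x. \<Sum>k<n. ip h (e k) * e k x) (e n)"
        using E_add[OF r_D[OF less.prems] sum_D e, of n "\<lambda>k. ip h (e k)" n n] by (simp only: split)
      moreover have "ip h (e n) = ip (r h n) (e n) + ip (\<lambda>x. \<Sum>k<n. ip h (e k) * e k x) (e n)"
        using ip_add[OF r_D[OF less.prems, THEN D_ell2] sum_D[THEN D_ell2] e[THEN D_ell2],
            of n "\<lambda>k. ip h (e k)" n n]
        by (simp only: split)
      ultimately show ?thesis
        using perp E_commute[of "e n" h] E_commute[of "e n" "r h n"]
          ip_commute[of "e n" h] ip_commute[of "e n" "r h n"] by simp
    qed
  qed
  \<comment> \<open>The residual and the projection are orthogonal for the energy too, by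
    \<open>eigen\<close>, so Pythagoras applies.\<close>
  have E_r: "\<E> (r f n) (r f n) \<le> \<E> f f" if f: "f \<in> \<D>" for f n
  proof -
    let ?p = "\<lambda>x. \<Sum>k<n. ip f (e k) * e k x"
    have "\<E> ?p (r f n) = (\<Sum>k<n. ip f (e k) * \<E> (e k) (r f n))"
      using e r_D[OF f] by (rule E_sum)
    also have "\<dots> = 0"
      using r_orth[OF f] by (intro sum.neutral) (simp add: eigen r_D f ip_commute[of "e _"])
    finally have "\<E> (r f n) ?p = 0"
      by (simp add: E_commute)
    then have "\<E> f f = \<E> (r f n) (r f n) + \<E> ?p ?p"
      using E_line[OF r_D[OF f] sum_D, of n 1 "\<lambda>k. ip f (e k)" n] by (simp add: split)
    then show ?thesis
      using E_nonneg[of ?p] by simp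
  qed
  \<comment> \<open>With bounded \<open>l\<close>, \<open>compactness\<close> gives a limit
    \<open>u\<close> of norm 1 of an orthonormal sequence. It is orthogonal to every
    \<open>e j\<close>, hence to itself, a contradiction.\<close>
  have unbounded: "\<exists>n. C < l n" if "I = UNIV" for C
  proof (rule ccontr)
    assume "\<nexists>n. C < l n"
    then have "\<E> (e n) (e n) \<le> max 1 C" "ip (e n) (e n) \<le> max 1 C" for n
      using unit[of n] that by (auto simp: l_def not_less le_max_iff_disj)
    then obtain s u L where s: "strict_mono s" and "u \<in> \<D>" and
      lim: "\<And>g. g \<in> \<D> \<Longrightarrow> (\<lambda>k. ip (e (s k)) g) \<longlonglongrightarrow> ip u g" and
      lim_self: "(\<lambda>k. ip (e (s k)) (e (s k))) \<longlonglongrightarrow> ip u u"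
      using compactness[of e, OF e] by blast
    have "ip u (e j) = 0" for j
    proof -
      have "\<forall>\<^sub>F k in sequentially. ip (e (s k)) (e j) = 0"
        using eventually_gt_at_top[of j]
      proof eventually_elim
        case (elim k)
        then show ?case
          using orth_less[of j "s k"] seq_suble[OF s, of k] by simp
      qed
      then show ?thesis
        by (rule LIMSEQ_unique[OF lim[OF e] tendsto_eventually])
    qed
    then have "ip (e (s k)) u = 0" for k
      by (subst ip_commute) simp
    then have "ip u u = 0"
      using lim[OF \<open>u \<in> \<D>\<close>] by (simp add: LIMSEQ_const_iff)
    moreover have "ip u u = 1"
      using lim_self unit that by (simp add: LIMSEQ_const_iff)
    ultimately show False by simp
  qed
  have approx: "\<exists>n. ell2_norm M (\<lambda>x. f x - (\<Sum>k\<in>{k\<in>I. k < n}. ip f (e k) * e k x)) < \<epsilon>"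
    if f: "f \<in> \<D>" and "0 < \<epsilon>" for f \<epsilon>
  proof -
    have r_eq: "(\<lambda>x. f x - (\<Sum>k\<in>{k\<in>I. k < n}. ip f (e k) * e k x)) = r f n" for n
      unfolding r_def
      by (intro ext arg_cong2[where f = minus] refl sum.mono_neutral_left) (auto simp: I_def fun_eq_iff)
    have "\<exists>n. ip (r f n) (r f n) < \<epsilon>\<^sup>2"
    proof (cases "I = UNIV")
      case False
      then obtain n where "n \<notin> I" by auto
      then have "r f n = (\<lambda>x. 0)"
        using exhausted r_D r_orth f by blast
      then show ?thesis
        using \<open>0 < \<epsilon>\<close> by (intro exI[of _ n]) (simp add: ip_zero)
    next
      case True
      \<comment> \<open>With \<open>l n\<close> this large, minimality of \<open>e n\<close> applied
        to the residual gives \<open>l n * ip (r f n) (r f n) \<le> \<E> f f < l n *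
        \<epsilon>\<^sup>2\<close>.\<close>
      obtain n where n: "\<E> f f / \<epsilon>\<^sup>2 < l n"
        using unbounded[OF True] by blast
      have ln: "0 < l n"
        using n E_nonneg[of f] \<open>0 < \<epsilon>\<close> by (meson divide_nonneg_nonneg le_less_trans zero_le_power2)
      have "l n * ip (r f n) (r f n) \<le> \<E> f f"
        using min[of n "r f n"] True r_D[OF f] r_orth[OF f] E_r[OF f, of n] by fastforce
      also have "\<dots> < l n * \<epsilon>\<^sup>2"
        using n \<open>0 < \<epsilon>\<close> by (simp add: pos_divide_less_eq)
      finally show ?thesis
        using ln by auto
    qed
    then show ?thesis
      using \<open>0 < \<epsilon>\<close> by (simp add: r_eq ell2_norm_less)
  qed
  show thesis
  proof (rule that[of e I l])
    show "ip (e j) (e k) = (if j = k then 1 else 0)" if "j \<in> I" "k \<in> I" for j k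
      using orth unit that by simp
  qed (fact e mono eigen approx)+
qed

section \<open>Closures, spans and eigenspaces\<close>

lemma subset_ell2_closure:
  assumes "V \<subseteq> ell2 M"
  shows "V \<subseteq> ell2_closure M V"
proof
  fix f assume "f \<in> V"
  moreover have "ell2_norm M (\<lambda>x. f x - f x) = 0"
    by (simp add: ell2_norm_def ip_zero)
  ultimately show "f \<in> ell2_closure M V"
    using assms by (force simp: ell2_closure_def intro: bexI[of _ f])
qed

text \<open>The parallelogram law with the difference term dropped; it stands in for the triangle
  inequality of the norm.\<close>

lemma ip_add_self_le:
  assumes "f \<in> ell2 M" "g \<in> ell2 M"
  shows "ip (\<lambda>x. f x + g x) (\<lambda>x. f x + g x) \<le> 2 * ip f f + 2 * ip g g"
  using ip_line[OF assms, of 1] ip_line[OF assms, of "-1"] ip_nonneg[of "\<lambda>x. f x + (-1) * g x"]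
  by simp

lemma ell2_closure_trans:
  assumes V: "V \<subseteq> ell2_closure M W" and W: "W \<subseteq> ell2 M"
  shows "ell2_closure M V \<subseteq> ell2_closure M W"
proof
  fix f assume f: "f \<in> ell2_closure M V"
  have "\<exists>h\<in>W. ell2_norm M (\<lambda>x. f x - h x) < \<epsilon>" if "0 < \<epsilon>" for \<epsilon>
  proof -
    have \<epsilon>: "0 < \<epsilon> / 2" using that by simp
    obtain g where g: "g \<in> V" "ell2_norm M (\<lambda>x. f x - g x) < \<epsilon> / 2"
      using f \<epsilon> unfolding ell2_closure_def by blast
    obtain h where h: "h \<in> W" "ell2_norm M (\<lambda>x. g x - h x) < \<epsilon> / 2"
      using V g(1) \<epsilon> unfolding ell2_closure_def by blast
    let ?p = "\<lambda>x. f x - g x" and ?q = "\<lambda>x. g x - h x"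
    have "f \<in> ell2 M" "g \<in> ell2 M" "h \<in> ell2 M"
      using f g(1) h(1) V W by (auto simp: ell2_closure_def)
    then have pq: "?p \<in> ell2 M" "?q \<in> ell2 M"
      using ell2_add[OF _ ell2_scale[of _ "-1"], of f g] ell2_add[OF _ ell2_scale[of _ "-1"], of g h]
      by simp_all
    have "ip (\<lambda>x. ?p x + ?q x) (\<lambda>x. ?p x + ?q x) \<le> 2 * ip ?p ?p + 2 * ip ?q ?q"
      using pq by (rule ip_add_self_le)
    also have "\<dots> < \<epsilon>\<^sup>2"
      using g(2) h(2) unfolding ell2_norm_less[OF \<epsilon>] by (simp add: power_divide)
    finally have "ip (\<lambda>x. f x - h x) (\<lambda>x. f x - h x) < \<epsilon>\<^sup>2"
      by simp
    then show ?thesis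
      using h(1) that by (auto simp: ell2_norm_less)
  qed
  then show "f \<in> ell2_closure M W"
    using f by (simp add: ell2_closure_def)
qed

lemma fun_span_subset: "B \<subseteq> \<D> \<Longrightarrow> fun_span B \<subseteq> \<D>"
  unfolding fun_span_def by (auto intro!: D_sum[of _ "\<lambda>g. g"])

text \<open>Coefficients in \<open>fun_span\<close> are indexed by the functions themselves, so
  injectivity of \<open>e\<close> lets them be carried over from the indices.\<close>

lemma sum_in_fun_span:
  assumes "inj_on e K" "finite K" "K \<subseteq> J"
  shows "(\<lambda>x. \<Sum>k\<in>K. a k * e k x) \<in> fun_span (e ` J)"
proof -
  have "(\<lambda>x. \<Sum>k\<in>K. a k * e k x) = (\<lambda>x. \<Sum>g\<in>e ` K. a (the_inv_into K e g) * g x)"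
    using assms(1) by (simp add: sum.reindex the_inv_into_f_f)
  also have "\<dots> \<in> fun_span (e ` J)"
    unfolding fun_span_def using assms(2,3)
    by (intro CollectI exI[of _ "e ` K"] exI[of _ "\<lambda>g. a (the_inv_into K e g)"]) auto
  finally show ?thesis .
qed

lemma D_subset_neumann: "\<D> \<subseteq> neumann_hilbert b M"
  unfolding neumann_hilbert_def form_domain_eq using D_ell2 by (intro subset_ell2_closure) auto

lemma eigenspace_iff: "f \<in> eigenspace b M t \<longleftrightarrow> f \<in> \<D> \<and> (\<forall>h\<in>\<D>. \<E> f h = t * ip f h)"
  using D_subset_neumann D_scale[of f t]
  by (auto simp: eigenspace_def neumann_operator_def form_domain_eq ip_scale)

lemma eigenspace_orthogonal:
  assumes "f \<in> eigenspace b M s" "g \<in> eigenspace b M t" "s \<noteq> t"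
  shows "ip f g = 0"
proof -
  have "s * ip f g = t * ip g f"
    using assms E_commute[of f g] by (simp add: eigenspace_iff)
  then show ?thesis
    using assms(3) ip_commute[of f g] by simp
qed

lemma spectral_decomposition:
  shows "pure_point_spectrum b M" and "\<exists>ev. eigenvalue_sequence b M ev"
proof -
  obtain e :: "nat \<Rightarrow> 'x \<Rightarrow> real" and I l where
    e: "\<And>k. e k \<in> \<D>" and
    on: "\<And>j k. j \<in> I \<Longrightarrow> k \<in> I \<Longrightarrow> ip (e j) (e k) = (if j = k then 1 else 0)" and
    mono: "\<And>j k. j \<le> k \<Longrightarrow> k \<in> I \<Longrightarrow> j \<in> I \<and> l j \<le> l k" and
    eigen: "\<And>k h. h \<in> \<D> \<Longrightarrow> \<E> (e k) h = l k * ip (e k) h" and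
    approx: "\<And>f \<epsilon>. f \<in> \<D> \<Longrightarrow> 0 < \<epsilon> \<Longrightarrow>
      \<exists>n. ell2_norm M (\<lambda>x. f x - (\<Sum>k\<in>{k\<in>I. k < n}. ip f (e k) * e k x)) < \<epsilon>"
    using eigenbasis by blast
  have inj: "inj_on e I"
    using on by (intro inj_onI) (metis zero_neq_one)
  have sub: "e ` J \<subseteq> \<D>" for J
    using e by auto
  have on': "\<forall>f\<in>e ` J. \<forall>g\<in>e ` J. ip f g = (if f = g then 1 else 0)" if "J \<subseteq> I" for J
    using on that inj by (auto simp: inj_on_eq_iff subset_iff)
  \<comment> \<open>Used with \<open>J = I\<close> for the whole space, and with the indices of one
    eigenvalue for its eigenspace, where the other Fourier coefficients vanish by orthogonality of
    eigenspaces.\<close>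
  have dense: "f \<in> ell2_closure M (fun_span (e ` J))"
    if f: "f \<in> \<D>" and J: "J \<subseteq> I" "\<And>k. k \<in> I - J \<Longrightarrow> ip f (e k) = 0" for f J
  proof -
    have "\<exists>g\<in>fun_span (e ` J). ell2_norm M (\<lambda>x. f x - g x) < \<epsilon>" if "0 < \<epsilon>" for \<epsilon>
    proof -
      obtain n where n: "ell2_norm M (\<lambda>x. f x - (\<Sum>k\<in>{k\<in>I. k < n}. ip f (e k) * e k x)) < \<epsilon>"
        using approx[OF f \<open>0 < \<epsilon>\<close>] by blast
      have "(\<Sum>k\<in>{k\<in>I. k < n}. ip f (e k) * e k x) = (\<Sum>k\<in>{k\<in>J. k < n}. ip f (e k) * e k x)" for x
        using J by (intro sum.mono_neutral_right) auto
      moreover have "(\<lambda>x. \<Sum>k\<in>{k\<in>J. k < n}. ip f (e k) * e k x) \<in> fun_span (e ` J)"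
        using inj J(1) by (intro sum_in_fun_span) (auto elim: inj_on_subset)
      ultimately show ?thesis
        using n by auto
    qed
    then show ?thesis
      using D_ell2[OF f] by (simp add: ell2_closure_def)
  qed
  show "pure_point_spectrum b M"
    unfolding pure_point_spectrum_def
  proof (intro exI[of _ "e ` I"] conjI ballI)
    have "\<D> \<subseteq> ell2_closure M (fun_span (e ` I))"
      using dense by blast
    moreover have "fun_span (e ` I) \<subseteq> ell2 M"
      using fun_span_subset[OF sub] D_ell2 by blast
    ultimately have "neumann_hilbert b M \<subseteq> ell2_closure M (fun_span (e ` I))"
      unfolding neumann_hilbert_def form_domain_eq by (rule ell2_closure_trans)
    then show "orthonormal_basis M (neumann_hilbert b M) (e ` I)"
      unfolding orthonormal_basis_def using sub[of I] D_subset_neumann on'[of I] by blast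
    fix f assume "f \<in> e ` I"
    then obtain k where k: "k \<in> I" "f = e k" by auto
    have "f \<noteq> (\<lambda>x. 0)"
      using on[OF k(1) k(1)] ip_zero[of f] k(2) by auto
    moreover have "f \<in> eigenspace b M (l k)"
      using e eigen k(2) by (simp add: eigenspace_iff)
    ultimately show "eigenvector b M f"
      by (auto simp: eigenvector_def)
  qed
  \<comment> \<open>Filling up with \<infinity> keeps the sequence increasing because
    \<open>I\<close> is an initial segment.\<close>
  define ev where "ev k = (if k \<in> I then ereal (l k) else \<infinity>)" for k
  have "\<exists>B. orthonormal_basis M (eigenspace b M t) B \<and> {k. ev k = ereal t} \<approx> B" for t
  proof (intro exI conjI)
    define J where "J = {k \<in> I. l k = t}"
    have "J \<subseteq> I" by (auto simp: J_def)
    have "f \<in> ell2_closure M (fun_span (e ` J))" if f: "f \<in> eigenspace b M t" for f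
    proof (rule dense)
      show "f \<in> \<D>"
        using f by (simp add: eigenspace_iff)
      show "ip f (e k) = 0" if "k \<in> I - J" for k
      proof (rule eigenspace_orthogonal[OF f])
        show "e k \<in> eigenspace b M (l k)"
          using e eigen by (simp add: eigenspace_iff)
      qed (use that in \<open>auto simp: J_def\<close>)
    qed fact
    moreover have "e ` J \<subseteq> eigenspace b M t"
      using e eigen by (auto simp: eigenspace_iff J_def)
    ultimately show "orthonormal_basis M (eigenspace b M t) (e ` J)"
      using on'[OF \<open>J \<subseteq> I\<close>] by (auto simp: orthonormal_basis_def)
    have "{k. ev k = ereal t} = J"
      by (auto simp: ev_def J_def)
    then show "{k. ev k = ereal t} \<approx> e ` J"
      using inj_on_subset[OF inj \<open>J \<subseteq> I\<close>] by (simp add: eqpoll_sym inj_on_image_eqpoll_self)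
  qed
  moreover have "mono ev"
  proof (rule monoI)
    show "ev j \<le> ev k" if "j \<le> k" for j k
      using mono[OF that] by (simp add: ev_def)
  qed
  moreover have "\<forall>k. ev k \<noteq> -\<infinity>"
    by (simp add: ev_def)
  ultimately have "eigenvalue_sequence b M ev"
    by (simp add: eigenvalue_sequence_def)
  then show "\<exists>ev. eigenvalue_sequence b M ev"
    by blast
qed

subsection \<open>Eigenvalue estimates\<close>

text \<open>Turns the multiplicity condition of an arbitrary eigenvalue sequence into a numbered
  orthonormal family: for each \<open>t\<close> the positions with value \<open>t\<close> are
  matched with a basis of its eigenspace.\<close>

lemma eigenvectors_of_sequence:
  assumes "eigenvalue_sequence b M ev"
  obtains e :: "nat \<Rightarrow> 'x \<Rightarrow> real" where
    "\<And>k t. ev k = ereal t \<Longrightarrow> e k \<in> eigenspace b M t"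
    "\<And>j k. ev j \<noteq> \<infinity> \<Longrightarrow> ev k \<noteq> \<infinity> \<Longrightarrow> ip (e j) (e k) = (if j = k then 1 else 0)"
proof -
  have "\<forall>t. \<exists>B \<phi>. orthonormal_basis M (eigenspace b M t) B \<and> bij_betw \<phi> {k. ev k = ereal t} B"
    using assms by (auto simp: eigenvalue_sequence_def eqpoll_def)
  then obtain B \<phi> where B: "\<And>t. orthonormal_basis M (eigenspace b M t) (B t)"
    and \<phi>: "\<And>t. bij_betw (\<phi> t) {k. ev k = ereal t} (B t)"
    by metis
  \<comment> \<open>At positions with value \<infinity> this is the arbitrary function
    \<open>\<phi> 0 k\<close>, which the conclusions exclude.\<close>
  define e where "e k = \<phi> (real_of_ereal (ev k)) k" for k
  have e_B: "e k \<in> B t" if "ev k = ereal t" for k t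
    using bij_betwE[OF \<phi>[of t]] that by (simp add: e_def)
  have e_eigen: "e k \<in> eigenspace b M t" if "ev k = ereal t" for k t
    using e_B[OF that] B[of t] by (auto simp: orthonormal_basis_def)
  have "ip (e j) (e k) = (if j = k then 1 else 0)" if fin: "ev j \<noteq> \<infinity>" "ev k \<noteq> \<infinity>" for j k
  proof -
    obtain s t where st: "ev j = ereal s" "ev k = ereal t"
      using assms fin by (cases "ev j"; cases "ev k") (auto simp: eigenvalue_sequence_def)
    show ?thesis
    proof (cases "s = t")
      case True
      have "e j = e k \<longleftrightarrow> j = k"
        using bij_betw_imp_inj_on[OF \<phi>[of t]] st True by (auto simp: e_def inj_on_def)
      then show ?thesis
        using B[of t] e_B st True by (simp add: orthonormal_basis_def)
    next
      case False
      then show ?thesis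
        using eigenspace_orthogonal[OF e_eigen e_eigen] st by auto
    qed
  qed
  then show thesis
    using that e_eigen by blast
qed

text \<open>One half of the min-max principle: the first \<open>n + 1\<close> eigenvectors span a nonzero function
  satisfying any \<open>n\<close> linear conditions. The conditions used are vanishing at \<open>x\<close> (\<open>Some x \<in> T\<close>)
  and orthogonality to the constants (\<open>None \<in> T\<close>).\<close>

lemma eigenvalue_lower_bound:
  assumes ev: "eigenvalue_sequence b M ev" and T: "finite T" "card T \<le> n" and K: "0 \<le> K"
    and bound: "\<And>f. f \<in> \<D> \<Longrightarrow> (\<And>x. Some x \<in> T \<Longrightarrow> f x = 0) \<Longrightarrow>
      (None \<in> T \<Longrightarrow> ip f (\<lambda>_. 1) = 0) \<Longrightarrow> ip f f \<le> K * \<E> f f"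
  shows "1 / ereal K \<le> ev n"
proof (cases "ev n = \<infinity>")
  case False
  obtain e :: "nat \<Rightarrow> 'x \<Rightarrow> real" where
    eigen: "\<And>k t. ev k = ereal t \<Longrightarrow> e k \<in> eigenspace b M t" and
    on: "\<And>j k. ev j \<noteq> \<infinity> \<Longrightarrow> ev k \<noteq> \<infinity> \<Longrightarrow> ip (e j) (e k) = (if j = k then 1 else 0)"
    using eigenvectors_of_sequence[OF ev] by blast
  define l where "l k = real_of_ereal (ev k)" for k
  have le: "ev k \<le> ev n" if "k \<le> n" for k
    using ev that by (auto simp: eigenvalue_sequence_def mono_def)
  have fin: "ev k \<noteq> \<infinity>" if "k \<le> n" for k
    using le[OF that] False by auto
  have l: "ev k = ereal (l k)" if "k \<le> n" for k
    using ev fin[OF that] by (cases "ev k") (auto simp: l_def eigenvalue_sequence_def)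
  have e_D: "e k \<in> \<D>" and e_E: "\<And>h. h \<in> \<D> \<Longrightarrow> \<E> (e k) h = l k * ip (e k) h" if "k \<le> n" for k
    using eigen[OF l[OF that]] by (auto simp: eigenspace_iff)
  obtain a where a: "\<exists>k\<in>{..n}. a k \<noteq> 0" and
    sol: "\<And>z. z \<in> T \<Longrightarrow>
      (\<Sum>k\<in>{..n}. (case z of None \<Rightarrow> ip (e k) (\<lambda>_. 1) | Some x \<Rightarrow> e k x) * a k) = 0"
    \<comment> \<open>There are \<open>n + 1\<close> unknown coefficients and at most
      \<open>n\<close> equations.\<close>
    using exists_nontrivial_solution[OF T(1), of "{..n}"
        "\<lambda>z k. case z of None \<Rightarrow> ip (e k) (\<lambda>_. 1) | Some x \<Rightarrow> e k x"] T(2) by auto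
  define f where "f x = (\<Sum>k\<in>{..n}. a k * e k x)" for x
  have f_eq: "f = (\<lambda>x. \<Sum>k\<in>{..n}. a k * e k x)"
    by (simp add: f_def fun_eq_iff)
  have f_D: "f \<in> \<D>"
    unfolding f_eq using e_D by (intro D_sum) auto
  have ip_f: "ip f h = (\<Sum>k\<in>{..n}. a k * ip (e k) h)" if "h \<in> \<D>" for h
    unfolding f_eq using e_D that by (intro ip_sum) auto
  have coeff: "ip (e j) f = a j" if "j \<le> n" for j
  proof -
    have "ip f (e j) = (\<Sum>k\<in>{..n}. if k = j then a j else 0)"
      unfolding ip_f[OF e_D[OF that]] using on fin that by (intro sum.cong) auto
    then show ?thesis
      using that by (simp add: ip_commute[of "e j"])
  qed
  have norm_f: "ip f f = (\<Sum>k\<in>{..n}. (a k)\<^sup>2)"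
    unfolding ip_f[OF f_D] using coeff by (intro sum.cong) (auto simp: power2_eq_square)
  have "\<E> f f = (\<Sum>k\<in>{..n}. a k * \<E> (e k) f)"
    using E_sum[of "{..n}" e f a] e_D f_D by (simp add: f_eq[symmetric])
  also have "\<dots> = (\<Sum>k\<in>{..n}. l k * (a k)\<^sup>2)"
    using e_E[OF _ f_D] coeff by (intro sum.cong) (auto simp: power2_eq_square)
  also have "\<dots> \<le> (\<Sum>k\<in>{..n}. l n * (a k)\<^sup>2)"
    using le l by (intro sum_mono mult_right_mono) auto
  finally have E_f: "\<E> f f \<le> l n * ip f f"
    by (simp add: norm_f sum_distrib_left)
  have pos: "0 < ip f f"
  proof -
    obtain k where "k \<le> n" "a k \<noteq> 0"
      using a by auto
    then show ?thesis
      unfolding norm_f by (intro sum_pos2[of _ k]) auto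
  qed
  have "ip f f \<le> K * \<E> f f"
  proof (rule bound[OF f_D])
    show "f x = 0" if "Some x \<in> T" for x
      using sol[OF that] by (simp add: f_def mult.commute)
    show "ip f (\<lambda>_. 1) = 0" if "None \<in> T"
      using sol[OF that] by (simp add: ip_f D_const mult.commute)
  qed
  also have "\<dots> \<le> K * (l n * ip f f)"
    using E_f K by (rule mult_left_mono)
  finally have "1 \<le> K * l n"
    using pos by simp
  then have "0 < K"
    using K by (cases "K = 0") auto
  then show ?thesis
    using \<open>1 \<le> K * l n\<close> by (simp add: l one_ereal_def pos_divide_le_eq mult.commute)
qed simp

text \<open>Nonnegativity of the energy gives one inequality. For the other, the constants are
  eigenvectors for 0, so 0 must occur in the sequence, and its first entry is the smallest.\<close>

lemma eigenvalue_sequence_0: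
  assumes ev: "eigenvalue_sequence b M ev"
  shows "ev 0 = 0"
proof -
  have "0 \<le> ev 0"
  proof (cases "ev 0")
    case (real t)
    obtain e :: "nat \<Rightarrow> 'x \<Rightarrow> real" where "e 0 \<in> eigenspace b M t" "ip (e 0) (e 0) = 1"
      using eigenvectors_of_sequence[OF ev] real by (metis PInfty_neq_ereal(1))
    then show ?thesis
      using E_nonneg[of "e 0"] real by (simp add: eigenspace_iff)
  qed (use ev in \<open>auto simp: eigenvalue_sequence_def\<close>)
  have "\<exists>k. ev k = ereal 0"
  proof (rule ccontr)
    assume none: "\<nexists>k. ev k = ereal 0"
    obtain B where B: "orthonormal_basis M (eigenspace b M 0) B" "{k. ev k = ereal 0} \<approx> B"
      using ev by (auto simp: eigenvalue_sequence_def)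
    moreover have "{k. ev k = ereal 0} = {}"
      using none by auto
    ultimately have "B = {}"
      using eqpoll_sym eqpoll_empty_iff_empty by metis
    have "(\<lambda>x. 1) \<in> eigenspace b M 0"
      by (simp add: eigenspace_iff D_const E_const)
    then have "(\<lambda>x. 1) \<in> ell2_closure M {\<lambda>x. 0}"
      using B(1) by (auto simp: orthonormal_basis_def fun_span_def \<open>B = {}\<close>)
    moreover have "0 < ell2_norm M (\<lambda>x. 1)"
      using ip_pos[OF D_ell2[OF D_const], of 1] by (simp add: ell2_norm_def fun_eq_iff)
    \<comment> \<open>Membership in the closure is tested with \<epsilon> equal to the norm of the
      constant 1, while 0 is the only available approximant.\<close>
    ultimately have "ell2_norm M (\<lambda>x. 1 - 0) < ell2_norm M (\<lambda>x. 1)"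
      unfolding ell2_closure_def by blast
    then show False by simp
  qed
  then obtain k where "ev k = 0"
    by (auto simp: zero_ereal_def)
  then have "ev 0 \<le> 0"
    using ev monoD[of ev 0 k] by (simp add: eigenvalue_sequence_def)
  with \<open>0 \<le> ev 0\<close> show ?thesis by simp
qed

text \<open>Vanishing at the \<open>n\<close> points of \<open>F\<close> and orthogonality to the
  constants are \<open>n + 1\<close> conditions, which explains the index.\<close>

lemma eigenvalue_bound_variation:
  assumes "eigenvalue_sequence b M ev" "finite F" "card F = n"
  shows "4 / (poincare_const b * ereal (measure M (UNIV - F))) \<le> ev (n + 1)"
proof -
  define \<mu> where "\<mu> = measure M (UNIV - F)"
  have "1 / ereal (cP * \<mu> / 4) \<le> ev (n + 1)"
  proof (rule eigenvalue_lower_bound[OF assms(1)])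
    show "finite (insert None (Some ` F))" "card (insert None (Some ` F)) \<le> n + 1"
      using assms by (auto simp: card_image)
    show "0 \<le> cP * \<mu> / 4"
      using cP_nonneg by (simp add: \<mu>_def)
    fix f assume f: "f \<in> \<D>" "\<And>x. Some x \<in> insert None (Some ` F) \<Longrightarrow> f x = 0"
      "None \<in> insert None (Some ` F) \<Longrightarrow> ip f (\<lambda>_. 1) = 0"
    obtain s where "\<And>x. (f x - s)\<^sup>2 \<le> cP * \<E> f f / 4"
      using poincare_midpoint[OF f(1)] by blast
    then have "ip f f \<le> (cP * \<E> f f / 4) * measure M (UNIV - F)"
      using f by (intro ip_self_le[OF f(1)]) auto
    then show "ip f f \<le> (cP * \<mu> / 4) * \<E> f f"
      by (simp add: \<mu>_def mult_ac)
  qed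
  \<comment> \<open>If the denominator is zero, both quotients are \<infinity>.\<close>
  moreover have "4 / (ereal cP * ereal \<mu>) = 1 / ereal (cP * \<mu> / 4)"
    by (cases "cP * \<mu> = 0") (auto simp: one_ereal_def divide_ereal_def field_simps)
  ultimately show ?thesis
    by (simp add: poincare_const_eq \<mu>_def)
qed

text \<open>A function supported in \<open>\<Omega>\<close> vanishes at some vertex, so its sup norm
  is bounded by its oscillation.\<close>

lemma poincare_const_on_le:
  assumes "\<Omega> \<noteq> UNIV"
  shows "poincare_const_on b \<Omega> \<le> poincare_const b"
  unfolding poincare_const_eq poincare_const_on_def
proof (rule Inf_lower, safe intro!: exI[of _ cP] cP_nonneg)
  fix f assume f: "f \<in> \<D>" "supp f \<subseteq> \<Omega>"
  then obtain y where "f y = 0"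
    using assms by (auto simp: supp_def)
  define R where "R = sqrt (cP * \<E> f f)"
  have "\<bar>f x\<bar> \<le> R" for x
    using D_bound[OF f(1), of x y] \<open>f y = 0\<close> by (simp add: R_def)
  then have "sup_norm f \<le> ereal R"
    unfolding sup_norm_def by (intro SUP_least) simp
  moreover have "0 \<le> sup_norm f"
    unfolding sup_norm_def by (rule SUP_upper2[of y]) auto
  ultimately obtain v where v: "sup_norm f = ereal v" "0 \<le> v" "v \<le> R"
    by (cases "sup_norm f") auto
  then have "v\<^sup>2 \<le> R\<^sup>2"
    by (intro power_mono)
  also have "R\<^sup>2 = cP * \<E> f f"
    using cP_nonneg E_nonneg by (simp add: R_def)
  finally show "(sup_norm f)\<^sup>2 \<le> ereal (cP * \<E> f f)"
    using v by simp
qed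

lemma poincare_on:
  assumes "poincare_const_on b \<Omega> = ereal d" "f \<in> \<D>" "supp f \<subseteq> \<Omega>"
  shows "(f x)\<^sup>2 \<le> d * \<E> f f"
proof (rule le_Inf_ereal_mult[OF _ E_nonneg assms(1)[unfolded poincare_const_on_def]])
  fix a assume "a \<in> {ereal r |r. 0 \<le> r \<and>
    (\<forall>f\<in>\<D>. supp f \<subseteq> \<Omega> \<longrightarrow> (sup_norm f)\<^sup>2 \<le> ereal (r * \<E> f f))}"
  then obtain r where r: "a = ereal r" "(sup_norm f)\<^sup>2 \<le> ereal (r * \<E> f f)"
    using assms by auto
  have x: "ereal \<bar>f x\<bar> \<le> sup_norm f"
    unfolding sup_norm_def by (rule SUP_upper) simp
  then obtain v where v: "sup_norm f = ereal v"
    using r(2) by (cases "sup_norm f") auto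
  then have "(f x)\<^sup>2 \<le> v\<^sup>2"
    using x by (simp add: abs_le_square_iff[symmetric])
  then show "\<exists>r. a = ereal r \<and> (f x)\<^sup>2 \<le> r * \<E> f f"
    using r v by auto
qed

text \<open>From \<open>1 \<le> n\<close> there is a vertex outside \<open>UNIV - F\<close>, which
  makes the constant finite. The test functions vanish on \<open>F\<close>, and
  \<open>ip_self_le\<close> is applied with \<open>s = 0\<close>.\<close>

lemma eigenvalue_bound_sup:
  assumes "eigenvalue_sequence b M ev" "finite F" "card F = n" "1 \<le> n"
  shows "1 / (poincare_const_on b (UNIV - F) * ereal (measure M (UNIV - F))) \<le> ev (n + 1)"
proof -
  have "F \<noteq> {}"
    using assms by auto
  then have "UNIV - F \<noteq> UNIV"
    by auto
  then have "poincare_const_on b (UNIV - F) \<le> ereal cP"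
    using poincare_const_on_le poincare_const_eq by metis
  moreover have "0 \<le> poincare_const_on b (UNIV - F)"
    unfolding poincare_const_on_def by (rule Inf_greatest) auto
  ultimately obtain d where d: "poincare_const_on b (UNIV - F) = ereal d" "0 \<le> d"
    by (cases "poincare_const_on b (UNIV - F)") auto
  have "1 / ereal (d * measure M (UNIV - F)) \<le> ev (n + 1)"
  proof (rule eigenvalue_lower_bound[OF assms(1)])
    show "finite (Some ` F)" "card (Some ` F) \<le> n + 1"
      using assms by (auto simp: card_image)
    show "0 \<le> d * measure M (UNIV - F)"
      using d by simp
    fix f assume f: "f \<in> \<D>" "\<And>x. Some x \<in> Some ` F \<Longrightarrow> f x = 0"
    then have "supp f \<subseteq> UNIV - F"
      by (auto simp: supp_def)
    then have "ip f f \<le> (d * \<E> f f) * measure M (UNIV - F)"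
      using f poincare_on[OF d(1) f(1)] by (intro ip_self_le[OF f(1), of F 0]) auto
    then show "ip f f \<le> (d * measure M (UNIV - F)) * \<E> f f"
      by (simp add: mult_ac)
  qed
  then show ?thesis
    by (simp add: d)
qed

end

theorem theorem6p2:
  fixes b :: "'x::countable \<Rightarrow> 'x \<Rightarrow> real" and M :: "'x measure"
  assumes "weighted_graph b" and "connected_graph b"
    and "finite_measure M" and "full_support_measure M"
    and "poincare_const b < \<infinity>"
  shows "pure_point_spectrum b M \<and>
    (\<exists>ev. eigenvalue_sequence b M ev) \<and>
    (\<forall>ev. eigenvalue_sequence b M ev \<longrightarrow>
       ev 0 = 0 \<and> 0 < ev 1 \<and>
       (\<forall>(n::nat) (F::'x set).
          finite F \<and> card F = n \<and> (\<forall>x\<in>F. indicator {x} \<in> dirichlet_space b) \<longrightarrow>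
            ev (n + 1) \<ge> 4 / (poincare_const b * ereal (measure M (UNIV - F))) \<and>
            (n \<ge> 1 \<longrightarrow>
               poincare_const_on b (UNIV - F) \<le> poincare_const b \<and>
               poincare_const b < \<infinity> \<and>
               ev (n + 1) \<ge> 1 / (poincare_const_on b (UNIV - F) * ereal (measure M (UNIV - F))))))"
proof -
  interpret poincare_graph b M
    using assms(1,3,4,5) by (rule poincare_graph.intro)
  show ?thesis
  proof (intro conjI allI impI)
    show "pure_point_spectrum b M" "\<exists>ev. eigenvalue_sequence b M ev"
      by (fact spectral_decomposition)+
    fix ev assume ev: "eigenvalue_sequence b M ev"
    show "ev 0 = 0"
      using ev by (rule eigenvalue_sequence_0)
    \<comment> \<open>Positivity of \<open>ev 1\<close> is part (a) with empty \<open>F\<close>; the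
      quotient is positive also for denominator zero, being \<infinity> then.\<close>
    have "0 < 4 / (poincare_const b * ereal (measure M (UNIV - {})))"
      using cP_nonneg by (cases "cP * measure M UNIV = 0")
        (auto simp: poincare_const_eq divide_ereal_def less_le)
    also have "\<dots> \<le> ev (0 + 1)"
      using ev by (rule eigenvalue_bound_variation) auto
    finally show "0 < ev 1" by simp
    fix n F assume F: "finite F \<and> card F = n \<and> (\<forall>x\<in>F. indicator {x} \<in> dirichlet_space b)"
    show "4 / (poincare_const b * ereal (measure M (UNIV - F))) \<le> ev (n + 1)"
      using ev F by (intro eigenvalue_bound_variation) auto
    show "poincare_const b < \<infinity>"
      by (fact assms)
    assume "1 \<le> n"
    then have "F \<noteq> {}"
      using F by auto
    then show "poincare_const_on b (UNIV - F) \<le> poincare_const b"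
      by (intro poincare_const_on_le) auto
    show "1 / (poincare_const_on b (UNIV - F) * ereal (measure M (UNIV - F))) \<le> ev (n + 1)"
      using ev F \<open>1 \<le> n\<close> by (intro eigenvalue_bound_sup) auto
  qed
qed

end
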